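(* There exist absolute constants $c>0$ and $c'>0$ such that for any $\alpha\in(0,c)$, $\varepsilon\in(0,1)$, and any integers $k,N$ with $k\le\frac12N$ and $N\ge\frac2{\alpha^2}$, there exists a workload $\mathcal{Q}$ of $k$ bounded queries on a universe of size $N$ for which \[ \mathrm{sc}_\varepsilon(\mathcal{Q},\alpha)\ge c'\min\left\{\frac{k}{\varepsilon\alpha},\ \frac{\sqrt{k\log(N/k)}}{\varepsilon\alpha},\ \frac{\log(\alpha^2N)}{\varepsilon\alpha^2}\right\}. \]
   Context: A universe $\mathcal{X}$ is a set; a dataset $X\in\mathcal{X}^n$ is a sequence of $n$ elements. A statistical query $q:\mathcal{X}\to\mathbb{R}$ is evaluated as $q(X)=\frac1n\sum_{x\in X}q(x)$ (with multiplicity). A workload $\mathcal{Q}=(q_1,\dots,q_k)$, $\mathcal{Q}(X)=(q_1(X),\dots,q_k(X))$; bounded means $|q_i(x)|\le1$ for all $i,x$. A mechanism maps datasets to random vectors in $\mathbb{R}^k$; it is $\varepsilon$-differentially private if for all $X,X'\in\mathcal{X}^n$ differing in at most one element and all measurable $S$, $\Pr(\mathcal{M}(X)\in S)\le e^\varepsilon\Pr(\mathcal{M}(X')\in S)$. $\mathrm{err}(\mathcal{M},\mathcal{Q},n)=\max_{X\in\mathcal{X}^n}\mathbb{E}[\frac1{\sqrt k}\|\mathcal{M}(X)-\mathcal{Q}(X)\|_2]$; $\mathrm{sc}(\mathcal{M},\mathcal{Q},\alpha)=\inf\{n:\mathrm{err}(\mathcal{M},\mathcal{Q},n)\le\alpha\}$;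 $\mathrm{sc}_\varepsilon(\mathcal{Q},\alpha)=\inf\{\mathrm{sc}(\mathcal{M},\mathcal{Q},\alpha):\mathcal{M}\ \varepsilon\text{-differentially private}\}$. *)

theory Defs
  imports "HOL-Probability.Probability"
begin

definition datasets :: "'x set \<Rightarrow> nat \<Rightarrow> 'x list set" where
  "datasets U n = {X. set X \<subseteq> U \<and> length X = n}"

definition query_value :: "('x \<Rightarrow> real) \<Rightarrow> 'x list \<Rightarrow> real" where
  "query_value q X = (\<Sum>x\<leftarrow>X. q x) / real (length X)"

text \<open>A workload \<open>(q\<^sub>1, \<dots>, q\<^sub>k)\<close> is a list of queries, with positions counted from 0.\<close>

definition bounded_workload :: "'x set \<Rightarrow> ('x \<Rightarrow> real) list \<Rightarrow> bool" where
  "bounded_workload U Q \<longleftrightarrow> (\<forall>q\<in>set Q. \<forall>x\<in>U. \<bar>q x\<bar> \<le> 1)"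

text \<open>The number of queries is a natural number quantified inside the theorem, so \<open>\<real>\<^sup>k\<close>
  with its Borel sets is the product space over the index set \<open>{..<k}\<close>.\<close>

abbreviation real_vectors :: "nat \<Rightarrow> (nat \<Rightarrow> real) measure" where
  "real_vectors k \<equiv> PiM {..<k} (\<lambda>_. borel)"

text \<open>A randomized mechanism is given by the output distribution on each dataset.\<close>

definition mechanism :: "'x set \<Rightarrow> nat \<Rightarrow> ('x list \<Rightarrow> (nat \<Rightarrow> real) measure) \<Rightarrow> bool" where
  "mechanism U k M \<longleftrightarrow>
    (\<forall>n. \<forall>X\<in>datasets U n. prob_space (M X) \<and> sets (M X) = sets (real_vectors k))"

definition neighbouring :: "'x list \<Rightarrow> 'x list \<Rightarrow> bool" where
  "neighbouring X X' \<longleftrightarrow> length X = length X' \<and> card {i. i < length X \<and> X ! i \<noteq> X' ! i} \<le> 1"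

definition diff_private ::
    "real \<Rightarrow> 'x set \<Rightarrow> nat \<Rightarrow> ('x list \<Rightarrow> (nat \<Rightarrow> real) measure) \<Rightarrow> bool" where
  "diff_private \<epsilon> U k M \<longleftrightarrow>
    (\<forall>n. \<forall>X\<in>datasets U n. \<forall>X'\<in>datasets U n. neighbouring X X' \<longrightarrow>
      (\<forall>S\<in>sets (real_vectors k). measure (M X) S \<le> exp \<epsilon> * measure (M X') S))"

text \<open>The expected error may be infinite, hence the nonnegative integral.  For a finite universe
  the supremum ranges over a finite set, so it is the maximum over all datasets of size \<open>n\<close>.\<close>

definition err ::
    "'x set \<Rightarrow> ('x list \<Rightarrow> (nat \<Rightarrow> real) measure) \<Rightarrow> ('x \<Rightarrow> real) list \<Rightarrow> nat \<Rightarrow> ennreal" where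
  "err U M Q n =
    (SUP X\<in>datasets U n.
      \<integral>\<^sup>+ y. ennreal (1 / sqrt (real (length Q)) *
               L2_set (\<lambda>i. y i - query_value (Q ! i) X) {..<length Q}) \<partial>M X)"

text \<open>Datasets are nonempty, since \<open>query_value\<close> divides by \<open>n\<close>; with \<open>n = 0\<close> allowed,
  every sample complexity would be \<open>0\<close>.  The infimum is taken in \<^typ>\<open>enat\<close>, so that it is
  \<open>\<infinity>\<close> if no dataset size works.\<close>

definition sample_complexity ::
    "'x set \<Rightarrow> ('x list \<Rightarrow> (nat \<Rightarrow> real) measure) \<Rightarrow> ('x \<Rightarrow> real) list \<Rightarrow> real \<Rightarrow> enat" where
  "sample_complexity U M Q \<alpha> = Inf {enat n | n. n \<ge> 1 \<and> err U M Q n \<le> ennreal \<alpha>}"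

definition private_sample_complexity ::
    "real \<Rightarrow> 'x set \<Rightarrow> ('x \<Rightarrow> real) list \<Rightarrow> real \<Rightarrow> enat" where
  "private_sample_complexity \<epsilon> U Q \<alpha> =
    Inf {sample_complexity U M Q \<alpha> | M.
           mechanism U (length Q) M \<and> diff_private \<epsilon> U (length Q) M}"

end

theory Submission
  imports Defs
begin

text \<open>
  Split part of the universe into \<open>S\<close> blocks of \<open>B\<close> elements.  A function \<open>A\<close> choosing one element
  per block gives a dataset in which each chosen element is repeated \<open>m\<close> times and all other rows
  are fixed.  For random \<open>\<plusminus>1\<close> queries and \<open>k\<close> of order at least \<open>S ln B\<close>, the normalized answers of
  two such datasets are at distance of order \<open>m sqrt S / n\<close> whenever the functions differ on a quarter
  of the blocks; this follows from a fourth-moment bound on Rademacher sums, which makes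
  \<open>E exp (- \<langle>q, z\<rangle>\<^sup>2 / (6 |z|\<^sup>2))\<close> bounded away from \<open>1\<close>, and a union bound.  With \<open>m\<close> of order
  \<open>\<alpha> n / sqrt S\<close> an accurate mechanism distinguishes these \<open>B ^ S\<close> datasets up to a small Hamming
  ball.  They pairwise differ in at most \<open>S m\<close> rows, so privacy forces \<open>\<epsilon> m\<close> to be at least of order
  \<open>ln B\<close>, that is, \<open>n\<close> to be at least of order \<open>sqrt S ln B / (\<epsilon> \<alpha>)\<close>.  It remains to optimize \<open>S\<close>.
\<close>

section \<open>Random sign matrices\<close>

abbreviation signs :: "'a set \<Rightarrow> ('a \<Rightarrow> real) set" where
  "signs I \<equiv> PiE I (\<lambda>_. {-1, 1})"

lemma finite_signs: "finite I \<Longrightarrow> finite (signs I)"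
  by (intro finite_PiE) auto

section \<open>Moments of Rademacher sums\<close>

text \<open>Conditioning on the sign at \<open>a\<close> leaves two symmetric shifts by
  \<open>z a\<close>. This is the induction step of both moment computations, which count over all
  sign vectors instead of using a probability space.\<close>

lemma sum_signs_insert:
  fixes f :: "real \<Rightarrow> real" and z :: "'a \<Rightarrow> real"
  assumes "finite I" "a \<notin> I"
  shows "(\<Sum>q\<in>signs (insert a I). f (\<Sum>i\<in>insert a I. z i * q i)) =
    (\<Sum>q\<in>signs I. f ((\<Sum>i\<in>I. z i * q i) + z a) + f ((\<Sum>i\<in>I. z i * q i) - z a))"
proof -
  \<comment> \<open>Members of \<open>signs I\<close> are \<open>undefined\<close> at
    \<open>a\<close>, so \<open>g(a := y)\<close> determines \<open>g\<close>.\<close>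
  have inj: "inj_on (\<lambda>(y, g). g(a := y)) ({-1, 1} \<times> signs I)"
  proof (intro inj_onI, clarify)
    fix y y' :: real and g g' :: "'a \<Rightarrow> real"
    assume g: "g \<in> signs I" "g' \<in> signs I" and eq: "g(a := y) = g'(a := y')"
    have "g i = g' i" for i
      using g assms(2) fun_cong[OF eq, of i] by (cases "i = a") (auto simp: PiE_def extensional_def)
    then show "y = y' \<and> g = g'"
      using fun_cong[OF eq, of a] by auto
  qed
  have *: "(\<Sum>i\<in>insert a I. z i * (q(a := y)) i) = (\<Sum>i\<in>I. z i * q i) + z a * y" for q y
  proof -
    have "(\<Sum>i\<in>I. z i * (q(a := y)) i) = (\<Sum>i\<in>I. z i * q i)"
      using assms(2) by (intro sum.cong) auto
    then show ?thesis using assms by simp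
  qed
  have "(\<Sum>q\<in>signs (insert a I). f (\<Sum>i\<in>insert a I. z i * q i)) =
      (\<Sum>(y, g)\<in>{-1, 1} \<times> signs I. f (\<Sum>i\<in>insert a I. z i * (g(a := y)) i))"
    unfolding PiE_insert_eq by (subst sum.reindex[OF inj]) (simp add: case_prod_unfold)
  also have "\<dots> = (\<Sum>y\<in>{-1, 1}. \<Sum>g\<in>signs I. f ((\<Sum>i\<in>I. z i * g i) + z a * y))"
    unfolding * by (simp add: sum.cartesian_product)
  finally show ?thesis
    by (simp add: sum.distrib)
qed

lemma rademacher_second_moment:
  fixes z :: "'a \<Rightarrow> real"
  assumes "finite I"
  shows "(\<Sum>q\<in>signs I. (\<Sum>i\<in>I. z i * q i)\<^sup>2) = 2 ^ card I * (\<Sum>i\<in>I. (z i)\<^sup>2)"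
  using assms
proof (induction I rule: finite_induct)
  case (insert a I)
  have card: "card (signs I) = 2 ^ card I"
    using insert(1) by (simp add: card_PiE numeral_2_eq_2)
  have "(\<Sum>q\<in>signs (insert a I). (\<Sum>i\<in>insert a I. z i * q i)\<^sup>2) =
      (\<Sum>q\<in>signs I. ((\<Sum>i\<in>I. z i * q i) + z a)\<^sup>2 + ((\<Sum>i\<in>I. z i * q i) - z a)\<^sup>2)"
    using sum_signs_insert[OF insert(1,2), of "\<lambda>x. x\<^sup>2"] .
  also have "\<dots> = (\<Sum>q\<in>signs I. 2 * (\<Sum>i\<in>I. z i * q i)\<^sup>2 + 2 * (z a)\<^sup>2)"
    by (intro sum.cong refl) (simp add: power2_eq_square algebra_simps)
  also have "\<dots> = 2 * (\<Sum>q\<in>signs I. (\<Sum>i\<in>I. z i * q i)\<^sup>2) + 2 ^ card I * (2 * (z a)\<^sup>2)"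
    by (simp add: sum.distrib sum_distrib_left card)
  finally show ?case
    using insert by (simp add: algebra_simps)
qed simp

text \<open>Odd powers of \<open>z a\<close> cancel between the two shifts, and the second moment
  handles the mixed term. The factor 3 is the Gaussian one.\<close>

lemma rademacher_fourth_moment:
  fixes z :: "'a \<Rightarrow> real"
  assumes "finite I"
  shows "(\<Sum>q\<in>signs I. (\<Sum>i\<in>I. z i * q i) ^ 4) \<le> 2 ^ card I * (3 * (\<Sum>i\<in>I. (z i)\<^sup>2)\<^sup>2)"
  using assms
proof (induction I rule: finite_induct)
  case (insert a I)
  define v where "v = (\<Sum>i\<in>I. (z i)\<^sup>2)"
  have card: "card (signs I) = 2 ^ card I"
    using insert(1) by (simp add: card_PiE numeral_2_eq_2)
  have "(\<Sum>q\<in>signs (insert a I). (\<Sum>i\<in>insert a I. z i * q i) ^ 4) =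
      (\<Sum>q\<in>signs I. ((\<Sum>i\<in>I. z i * q i) + z a) ^ 4 + ((\<Sum>i\<in>I. z i * q i) - z a) ^ 4)"
    using sum_signs_insert[OF insert(1,2), of "\<lambda>x. x ^ 4"] .
  also have "\<dots> = (\<Sum>q\<in>signs I. 2 * (\<Sum>i\<in>I. z i * q i) ^ 4 +
      12 * (z a)\<^sup>2 * (\<Sum>i\<in>I. z i * q i)\<^sup>2 + 2 * (z a) ^ 4)"
    by (intro sum.cong refl) (simp add: power2_eq_square power4_eq_xxxx algebra_simps)
  also have "\<dots> = 2 * (\<Sum>q\<in>signs I. (\<Sum>i\<in>I. z i * q i) ^ 4) +
      12 * (z a)\<^sup>2 * (\<Sum>q\<in>signs I. (\<Sum>i\<in>I. z i * q i)\<^sup>2) + 2 ^ card I * (2 * (z a) ^ 4)"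
    by (simp add: sum.distrib sum_distrib_left card)
  also have "\<dots> \<le> 2 * (2 ^ card I * (3 * v\<^sup>2)) +
      12 * (z a)\<^sup>2 * (2 ^ card I * v) + 2 ^ card I * (2 * (z a) ^ 4)"
    using insert(3) rademacher_second_moment[OF insert(1), of z] by (simp add: v_def)
  \<comment> \<open>Enlarging the coefficient 2 to 6 completes the square in the next line.\<close>
  also have "\<dots> \<le> 2 * (2 ^ card I * (3 * v\<^sup>2)) +
      12 * (z a)\<^sup>2 * (2 ^ card I * v) + 2 ^ card I * (6 * (z a) ^ 4)"
    by simp
  also have "\<dots> = 2 ^ card (insert a I) * (3 * (v + (z a)\<^sup>2)\<^sup>2)"
    using insert(1,2) by (simp add: power2_eq_square power4_eq_xxxx algebra_simps)
  finally show ?case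
    using insert(1,2) by (simp add: v_def add.commute)
qed simp

text \<open>Follows from \<open>1 + x ^ 3 = (1 - x + x\<^sup>2) * (1 + x)\<close> and
  \<open>1 + x \<le> exp x\<close>. With \<open>x\<close> a scaled square, only second and fourth
  moments are needed to bound an exponential moment.\<close>

lemma exp_minus_le:
  fixes x :: real
  assumes "0 \<le> x"
  shows "exp (- x) \<le> 1 - x + x\<^sup>2"
proof -
  have "1 \<le> 1 + x ^ 3" using assms by simp
  also have "1 + x ^ 3 = (1 - x + x\<^sup>2) * (1 + x)"
    by (simp add: power2_eq_square power3_eq_cube algebra_simps)
  also have "\<dots> \<le> (1 - x + x\<^sup>2) * exp x"
  proof (rule mult_left_mono)
    show "1 + x \<le> exp x" by simp
    have "0 \<le> (x - 1 / 2)\<^sup>2 + 3 / 4" by (intro add_nonneg_nonneg) auto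
    then show "0 \<le> 1 - x + x\<^sup>2" by (simp add: power2_eq_square algebra_simps)
  qed
  finally show ?thesis by (simp add: exp_minus divide_simps)
qed

text \<open>The exponent \<open>1 / (6 v)\<close> minimizes \<open>1 - v t + 3 v\<^sup>2 t\<^sup>2\<close> over \<open>t\<close>.\<close>

lemma rademacher_exp_moment:
  fixes z :: "'a \<Rightarrow> real"
  assumes "finite I" and v: "v = (\<Sum>i\<in>I. (z i)\<^sup>2)" "0 < v"
  shows "(\<Sum>q\<in>signs I. exp (- ((\<Sum>i\<in>I. z i * q i)\<^sup>2 / (6 * v)))) \<le> 2 ^ card I * exp (- 1 / 12)"
proof -
  have card: "card (signs I) = 2 ^ card I"
    using assms(1) by (simp add: card_PiE numeral_2_eq_2)
  have "(\<Sum>q\<in>signs I. exp (- ((\<Sum>i\<in>I. z i * q i)\<^sup>2 / (6 * v)))) \<le>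
      (\<Sum>q\<in>signs I. 1 - (\<Sum>i\<in>I. z i * q i)\<^sup>2 / (6 * v) + ((\<Sum>i\<in>I. z i * q i)\<^sup>2 / (6 * v))\<^sup>2)"
    using v(2) by (intro sum_mono exp_minus_le) simp
  also have "\<dots> = 2 ^ card I - (\<Sum>q\<in>signs I. (\<Sum>i\<in>I. z i * q i)\<^sup>2) / (6 * v) +
      (\<Sum>q\<in>signs I. (\<Sum>i\<in>I. z i * q i) ^ 4) / (6 * v)\<^sup>2"
    by (simp add: sum.distrib sum_subtractf card sum_divide_distrib power_divide flip: power_mult)
  also have "\<dots> \<le> 2 ^ card I - (2 ^ card I * v) / (6 * v) + (2 ^ card I * (3 * v\<^sup>2)) / (6 * v)\<^sup>2"
    using rademacher_second_moment[OF assms(1), of z] rademacher_fourth_moment[OF assms(1), of z]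
    by (intro add_mono diff_mono divide_right_mono) (use v(2) in \<open>simp_all add: v(1)[symmetric]\<close>)
  \<comment> \<open>The arithmetic is 1 - 1/6 + 3/36 = 1 - 1/12.\<close>
  also have "\<dots> = 2 ^ card I * (1 + (- 1 / 12))"
    using v(2) by (simp add: field_simps power2_eq_square)
  also have "\<dots> \<le> 2 ^ card I * exp (- 1 / 12)"
    by (intro mult_left_mono exp_ge_add_one_self) auto
  finally show ?thesis .
qed

section \<open>Sign matrices that shrink none of finitely many vectors too much\<close>

text \<open>Exponential-moment union bound. The weight \<open>W z P\<close> is at least 1 whenever
  \<open>P\<close> fails for \<open>z\<close>, but its average over all \<open>P\<close> is at most
  exp (k/24 - k/12) = exp (- k/24). With fewer than exp (k/24) vectors, not every \<open>P\<close>
  can fail.\<close>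

lemma exists_sign_matrix:
  fixes Z :: "('a \<Rightarrow> real) set"
  assumes I: "finite I" and Z: "finite Z"
    and pos: "\<And>z. z \<in> Z \<Longrightarrow> 0 < (\<Sum>i\<in>I. (z i)\<^sup>2)"
    and card_Z: "real (card Z) < exp (real k / 24)"
  shows "\<exists>P :: nat \<Rightarrow> 'a \<Rightarrow> real. (\<forall>j<k. \<forall>i\<in>I. \<bar>P j i\<bar> = 1) \<and>
    (\<forall>z\<in>Z. real k / 4 * (\<Sum>i\<in>I. (z i)\<^sup>2) < (\<Sum>j<k. (\<Sum>i\<in>I. z i * P j i)\<^sup>2))"
proof -
  define \<P> where "\<P> = (\<Pi>\<^sub>E j\<in>{..<k}. signs I)"
  define v where "v z = (\<Sum>i\<in>I. (z i)\<^sup>2)" for z :: "'a \<Rightarrow> real"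
  define F where "F z P = (\<Sum>j<k. (\<Sum>i\<in>I. z i * P j i)\<^sup>2)" for z and P :: "nat \<Rightarrow> 'a \<Rightarrow> real"
  define W where "W z P = exp (real k / 24 - F z P / (6 * v z))" for z P
  have fin: "finite \<P>"
    unfolding \<P>_def using I by (intro finite_PiE finite_signs) auto
  have card: "real (card \<P>) = (2 ^ card I) ^ k"
    using I by (simp add: \<P>_def card_PiE numeral_2_eq_2)
  have W_sum: "(\<Sum>P\<in>\<P>. W z P) \<le> exp (- real k / 24) * card \<P>" if "z \<in> Z" for z
  proof -
    have "(\<Sum>P\<in>\<P>. W z P) = exp (real k / 24) *
        (\<Sum>P\<in>\<P>. \<Prod>j<k. exp (- ((\<Sum>i\<in>I. z i * P j i)\<^sup>2 / (6 * v z))))"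
      unfolding sum_distrib_left
      by (intro sum.cong refl)
        (simp add: W_def F_def sum_divide_distrib sum_negf flip: exp_sum exp_add)
    \<comment> \<open>The rows of \<open>P\<close> range independently over \<open>signs I\<close>,
      so the sum of products over rows is a k-th power.\<close>
    also have "\<dots> = exp (real k / 24) *
        (\<Sum>q\<in>signs I. exp (- ((\<Sum>i\<in>I. z i * q i)\<^sup>2 / (6 * v z)))) ^ k"
      unfolding \<P>_def using I by (subst prod_sum_PiE[symmetric]) (auto intro: finite_signs)
    also have "\<dots> \<le> exp (real k / 24) * (2 ^ card I * exp (- 1 / 12)) ^ k"
      using pos[OF that] I
      by (intro mult_left_mono power_mono rademacher_exp_moment sum_nonneg) (auto simp: v_def)
    also have "\<dots> = (exp (real k / 24) * exp (- 1 / 12) ^ k) * card \<P>"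
      by (simp add: power_mult_distrib card)
    also have "exp (real k / 24) * exp (- 1 / 12) ^ k = exp (- real k / 24)"
      by (simp flip: exp_of_nat_mult exp_add)
    finally show ?thesis .
  qed
  have "\<exists>P\<in>\<P>. \<forall>z\<in>Z. real k / 4 * v z < F z P"
  proof (rule ccontr)
    assume "\<not> ?thesis"
    then have bad: "\<exists>z\<in>Z. F z P \<le> real k / 4 * v z" if "P \<in> \<P>" for P
      using that by (meson not_less)
    have "1 \<le> (\<Sum>z\<in>Z. W z P)" if "P \<in> \<P>" for P
    proof -
      obtain z where z: "z \<in> Z" "F z P \<le> real k / 4 * v z" using bad[OF \<open>P \<in> \<P>\<close>] by blast
      have "0 < v z" using pos[OF z(1)] by (simp add: v_def)
      then have "1 \<le> W z P" using z(2) by (simp add: W_def field_simps)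
      also have "\<dots> \<le> (\<Sum>z\<in>Z. W z P)"
        using Z z(1) by (intro member_le_sum) (auto simp: W_def)
      finally show ?thesis .
    qed
    then have "(\<Sum>P\<in>\<P>. 1) \<le> (\<Sum>P\<in>\<P>. \<Sum>z\<in>Z. W z P)"
      by (rule sum_mono)
    also have "\<dots> = (\<Sum>z\<in>Z. \<Sum>P\<in>\<P>. W z P)" by (rule sum.swap)
    also have "\<dots> \<le> (\<Sum>z\<in>Z. exp (- real k / 24) * card \<P>)"
      using W_sum by (rule sum_mono)
    finally have "real (card \<P>) \<le> real (card Z) * exp (- real k / 24) * card \<P>" by simp
    moreover have "real (card Z) * exp (- real k / 24) < 1"
      using card_Z by (simp add: exp_minus field_simps)
    ultimately show False
      using card by (simp add: mult_le_cancel_right1)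
  qed
  then obtain P where P: "P \<in> \<P>" "\<forall>z\<in>Z. real k / 4 * v z < F z P" by blast
  have "\<bar>P j i\<bar> = 1" if "j < k" "i \<in> I" for i j
  proof -
    have "P j \<in> signs I" using P(1) that(1) unfolding \<P>_def by (auto dest: PiE_mem)
    then have "P j i \<in> {-1, 1}" using that(2) by (rule PiE_mem)
    then show ?thesis by auto
  qed
  with P(2) show ?thesis unfolding v_def F_def by blast
qed

section \<open>Packing bound for private mechanisms\<close>

text \<open>Change the differing rows one at a time; each change costs a factor
  \<open>exp \<epsilon>\<close>.\<close>

lemma group_privacy:
  assumes dp: "diff_private \<epsilon> U k M" and S: "S \<in> sets (real_vectors k)"
    and \<epsilon>: "0 \<le> \<epsilon>"
    and X: "X \<in> datasets U n" and X': "X' \<in> datasets U n"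
    and d: "card {i. i < n \<and> X ! i \<noteq> X' ! i} \<le> d"
  shows "measure (M X) S \<le> exp (\<epsilon> * d) * measure (M X') S"
  using X d
proof (induction d arbitrary: X)
  case 0
  then have "X = X'" using X' by (intro nth_equalityI) (auto simp: datasets_def)
  then show ?case by simp
next
  case (Suc d)
  let ?D = "\<lambda>X. {i. i < n \<and> X ! i \<noteq> X' ! i}"
  have len: "length X = n" "length X' = n" using Suc.prems X' by (auto simp: datasets_def)
  show ?case
  proof (cases "?D X = {}")
    case True
    then have "X = X'" using len by (intro nth_equalityI) auto
    \<comment> \<open>Since \<open>d\<close> only bounds the number of differing rows, equal
      datasets need the factor to be at least 1, which is where \<open>0 \<le> \<epsilon>\<close>
      enters.\<close>
    have "1 * measure (M X') S \<le> exp (\<epsilon> * Suc d) * measure (M X') S"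
      using \<epsilon> by (intro mult_right_mono) auto
    with \<open>X = X'\<close> show ?thesis by simp
  next
    case False
    then obtain i where i: "i < n" "X ! i \<noteq> X' ! i" by auto
    \<comment> \<open>Copying one differing row from \<open>X'\<close> gives a neighbour of
      \<open>X\<close> that is one row closer to \<open>X'\<close>.\<close>
    define Y where "Y = X[i := X' ! i]"
    have "X' ! i \<in> U" using X' i len by (auto simp: datasets_def)
    then have Y: "Y \<in> datasets U n"
      using Suc.prems(1) by (auto simp: datasets_def Y_def dest!: subsetD[OF set_update_subset_insert])
    have "?D Y = ?D X - {i}" using i len by (auto simp: Y_def nth_list_update)
    then have "card (?D Y) \<le> d" using Suc.prems(2) i by (simp add: card_Diff_singleton)
    note IH = Suc.IH[OF Y this]
    have "X ! j = Y ! j" if "j \<noteq> i" for j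
      using that by (simp add: Y_def)
    then have "{j. j < length X \<and> X ! j \<noteq> Y ! j} \<subseteq> {i}"
      by blast
    then have "card {j. j < length X \<and> X ! j \<noteq> Y ! j} \<le> 1"
      using card_mono[of "{i}"] by fastforce
    then have "neighbouring X Y" by (simp add: neighbouring_def Y_def)
    then have "measure (M X) S \<le> exp \<epsilon> * measure (M Y) S"
      using dp S Suc.prems(1) Y by (auto simp: diff_private_def)
    also have "\<dots> \<le> exp \<epsilon> * (exp (\<epsilon> * d) * measure (M X') S)"
      using IH by simp
    also have "\<dots> = exp (\<epsilon> * Suc d) * measure (M X') S"
      by (simp add: algebra_simps flip: exp_add)
    finally show ?thesis .
  qed
qed

section \<open>Accurate private mechanisms and overlapping balls\<close>

text \<open>Unlike the error, this distance is not divided by the root of the number of queries;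
  hence the factors \<open>sqrt (length Q)\<close> in the thresholds.\<close>

definition answer_dist :: "('x \<Rightarrow> real) list \<Rightarrow> 'x list \<Rightarrow> 'x list \<Rightarrow> real" where
  "answer_dist Q X X' = L2_set (\<lambda>j. query_value (Q ! j) X - query_value (Q ! j) X') {..<length Q}"

text \<open>Markov's inequality at four times the error bound: the output leaves the ball
  \<open>G\<close> around the true answers with probability at most 1/4.\<close>

lemma accurate_concentrated:
  assumes M: "mechanism U (length Q) M" and X: "X \<in> datasets U n"
    and err: "err U M Q n \<le> ennreal \<alpha>" and \<alpha>: "0 < \<alpha>" and Q: "Q \<noteq> []"
  defines "G \<equiv> {y \<in> space (real_vectors (length Q)).
    L2_set (\<lambda>j. y j - query_value (Q ! j) X) {..<length Q} < 4 * \<alpha> * sqrt (length Q)}"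
  shows "G \<in> sets (real_vectors (length Q))" and "3 / 4 \<le> measure (M X) G"
proof -
  let ?k = "length Q"
  let ?f = "\<lambda>y. 1 / sqrt ?k * L2_set (\<lambda>j. y j - query_value (Q ! j) X) {..<?k}"
  have k: "0 < sqrt ?k" using Q by simp
  have meas: "(\<lambda>y. L2_set (\<lambda>j. y j - query_value (Q ! j) X) {..<?k})
      \<in> borel_measurable (real_vectors ?k)"
    unfolding L2_set_def by measurable
  then show G: "G \<in> sets (real_vectors ?k)"
    unfolding G_def by measurable
  interpret prob_space "M X" using M X by (auto simp: mechanism_def)
  have sets: "sets (M X) = sets (real_vectors ?k)" using M X by (auto simp: mechanism_def)
  have space: "space (M X) = space (real_vectors ?k)" by (rule sets_eq_imp_space_eq[OF sets])
  have f: "?f \<in> borel_measurable (M X)"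
    unfolding measurable_cong_sets[OF sets refl] by (intro borel_measurable_times meas) simp
  have int: "(\<integral>\<^sup>+ y. ennreal (?f y) \<partial>M X) \<le> ennreal \<alpha>"
    using err unfolding err_def by (rule order_trans[OF SUP_upper[OF X]])
  have "emeasure (M X) {y \<in> space (M X). 1 \<le> ennreal (1 / (4 * \<alpha>)) * ennreal (?f y)} \<le>
      ennreal (1 / (4 * \<alpha>)) * (\<integral>\<^sup>+ y. ennreal (?f y) * indicator (space (M X)) y \<partial>M X)"
    using f by (intro nn_integral_Markov_inequality) auto
  also have "\<dots> = ennreal (1 / (4 * \<alpha>)) * (\<integral>\<^sup>+ y. ennreal (?f y) \<partial>M X)"
    by (simp cong: nn_integral_cong)
  also have "\<dots> \<le> ennreal (1 / (4 * \<alpha>)) * ennreal \<alpha>"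
    using int by (intro mult_left_mono) auto
  also have "\<dots> = ennreal (1 / 4)"
    using \<alpha> by (simp flip: ennreal_mult)
  also have "{y \<in> space (M X). 1 \<le> ennreal (1 / (4 * \<alpha>)) * ennreal (?f y)} = space (M X) - G"
  proof -
    have "1 \<le> ennreal (1 / (4 * \<alpha>)) * ennreal (?f y) \<longleftrightarrow> 1 \<le> 1 / (4 * \<alpha>) * ?f y" for y
      using \<alpha> k by (simp flip: ennreal_mult)
    also have "1 \<le> 1 / (4 * \<alpha>) * ?f y \<longleftrightarrow>
        4 * \<alpha> * sqrt ?k \<le> L2_set (\<lambda>j. y j - query_value (Q ! j) X) {..<?k}" for y
      using \<alpha> k by (simp add: field_simps)
    finally have "1 \<le> ennreal (1 / (4 * \<alpha>)) * ennreal (?f y) \<longleftrightarrow>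
        4 * \<alpha> * sqrt ?k \<le> L2_set (\<lambda>j. y j - query_value (Q ! j) X) {..<?k}" for y .
    then show ?thesis unfolding G_def space by (simp only: set_eq_iff mem_Collect_eq Diff_iff) linarith
  qed
  finally have "measure (M X) (space (M X) - G) \<le> 1 / 4"
    by (simp add: emeasure_eq_measure)
  then show "3 / 4 \<le> measure (M X) G"
    using prob_compl[of G] G unfolding sets by linarith
qed

text \<open>Instead of requiring disjoint balls around the true answers, it suffices that every point
  lies in at most \<open>V\<close> of them.\<close>

lemma packing_bound:
  fixes X :: "'i \<Rightarrow> 'x list"
  assumes M: "mechanism U (length Q) M" and dp: "diff_private \<epsilon> U (length Q) M"
    and err: "err U M Q n \<le> ennreal \<alpha>" and \<alpha>: "0 < \<alpha>" and \<epsilon>: "0 \<le> \<epsilon>" and Q: "Q \<noteq> []"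
    and I: "finite I" and X: "\<And>i. i \<in> I \<Longrightarrow> X i \<in> datasets U n"
    and d: "\<And>i j. i \<in> I \<Longrightarrow> j \<in> I \<Longrightarrow> card {l. l < n \<and> X i ! l \<noteq> X j ! l} \<le> d"
    and V: "\<And>i. i \<in> I \<Longrightarrow>
      real (card {j \<in> I. answer_dist Q (X i) (X j) \<le> 8 * \<alpha> * sqrt (length Q)}) \<le> V"
    and V0: "0 \<le> V"
  shows "3 / 4 * real (card I) \<le> exp (\<epsilon> * d) * V"
proof (cases "I = {}")
  case True
  then show ?thesis using V0 by simp
next
  case False
  then obtain i0 where i0: "i0 \<in> I" by auto
  let ?k = "length Q"
  define R where "R = 4 * \<alpha> * sqrt ?k"
  define G where "G i = {y \<in> space (real_vectors ?k).
    L2_set (\<lambda>j. y j - query_value (Q ! j) (X i)) {..<?k} < R}" for i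
  have G: "G i \<in> sets (real_vectors ?k)" "3 / 4 \<le> measure (M (X i)) (G i)" if "i \<in> I" for i
    using accurate_concentrated[OF M X[OF that] err \<alpha> Q] by (simp_all add: G_def R_def)
  interpret prob_space "M (X i0)" using M X[OF i0] by (auto simp: mechanism_def)
  have sets: "sets (M (X i0)) = sets (real_vectors ?k)" using M X[OF i0] by (auto simp: mechanism_def)
  have int: "integrable (M (X i0)) (indicat_real (G i))" if "i \<in> I" for i
    using G(1)[OF that] sets by (intro integrable_real_indicator) (auto simp: less_top[symmetric])
  have mult: "(\<Sum>i\<in>I. indicator (G i) y) \<le> V" for y :: "nat \<Rightarrow> real"
  proof -
    have "(\<Sum>i\<in>I. indicator (G i) y) = real (card {i \<in> I. y \<in> G i})"
      using I by (simp add: indicator_def sum.If_cases Int_def)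
    also have "\<dots> \<le> V"
    proof (cases "{i \<in> I. y \<in> G i} = {}")
      case True
      then show ?thesis using V0 by (simp only: card.empty)
    next
      case False
      then obtain i where i: "i \<in> I" "y \<in> G i" by auto
      \<comment> \<open>If \<open>y\<close> lies in two balls of radius \<open>R\<close>, their
        centres are within 2 \<open>R\<close> by the triangle inequality. So all balls containing
        \<open>y\<close> belong to the neighbourhood of one fixed centre \<open>i\<close>.\<close>
      have "{j \<in> I. y \<in> G j} \<subseteq> {j \<in> I. answer_dist Q (X i) (X j) \<le> 8 * \<alpha> * sqrt ?k}"
      proof safe
        fix j assume "j \<in> I" "y \<in> G j"
        have "answer_dist Q (X i) (X j) =
            L2_set (\<lambda>l. (query_value (Q ! l) (X i) - y l) + (y l - query_value (Q ! l) (X j))) {..<?k}"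
          by (simp add: answer_dist_def)
        also have "\<dots> \<le> L2_set (\<lambda>l. query_value (Q ! l) (X i) - y l) {..<?k} +
            L2_set (\<lambda>l. y l - query_value (Q ! l) (X j)) {..<?k}"
          by (rule L2_set_triangle_ineq)
        also have "L2_set (\<lambda>l. query_value (Q ! l) (X i) - y l) {..<?k} =
            L2_set (\<lambda>l. y l - query_value (Q ! l) (X i)) {..<?k}"
          unfolding L2_set_def by (simp add: power2_commute)
        also have "\<dots> + L2_set (\<lambda>l. y l - query_value (Q ! l) (X j)) {..<?k} \<le> R + R"
          using i(2) \<open>y \<in> G j\<close> by (intro add_mono) (auto simp: G_def)
        finally show "answer_dist Q (X i) (X j) \<le> 8 * \<alpha> * sqrt ?k"
          by (simp add: R_def)
      qed
      then have "card {j \<in> I. y \<in> G j} \<le>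
          card {j \<in> I. answer_dist Q (X i) (X j) \<le> 8 * \<alpha> * sqrt ?k}"
        using I by (intro card_mono) auto
      then show ?thesis using V[OF i(1)] by linarith
    qed
    finally show ?thesis .
  qed
  \<comment> \<open>Group privacy transfers every ball's mass to the single reference dataset
    \<open>X i0\<close>. There the masses add up to the expected number of balls containing the
    output, at most \<open>V\<close>.\<close>
  have "3 / 4 * real (card I) = (\<Sum>i\<in>I. 3 / 4)" by simp
  also have "\<dots> \<le> (\<Sum>i\<in>I. exp (\<epsilon> * d) * measure (M (X i0)) (G i))"
  proof (rule sum_mono)
    fix i assume i: "i \<in> I"
    show "3 / 4 \<le> exp (\<epsilon> * d) * measure (M (X i0)) (G i)"
      using G(2)[OF i] group_privacy[OF dp G(1)[OF i] \<epsilon> X[OF i] X[OF i0] d[OF i i0]]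
      by (rule order_trans)
  qed
  also have "\<dots> = exp (\<epsilon> * d) * (\<Sum>i\<in>I. measure (M (X i0)) (G i))"
    by (simp add: sum_distrib_left)
  also have "(\<Sum>i\<in>I. measure (M (X i0)) (G i)) = (\<integral>y. (\<Sum>i\<in>I. indicator (G i) y) \<partial>M (X i0))"
    using G(1) sets int by (subst Bochner_Integration.integral_sum) auto
  also have "\<dots> \<le> (\<integral>y. V \<partial>M (X i0))"
    using int by (intro integral_mono mult Bochner_Integration.integrable_sum) auto
  also have "\<dots> = V" by (simp add: prob_space)
  finally show ?thesis by simp
qed

text \<open>Both infima live in \<open>enat\<close>, so \<open>L\<close> is first rounded up to a
  natural number. An infimum over the empty set is \<infinity>, so only sizes that some private
  mechanism achieves have to be considered.\<close>

lemma private_sample_complexity_ge: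
  assumes "\<And>M n. mechanism U (length Q) M \<Longrightarrow> diff_private \<epsilon> U (length Q) M \<Longrightarrow> 1 \<le> n \<Longrightarrow>
    err U M Q n \<le> ennreal \<alpha> \<Longrightarrow> L \<le> real n"
  shows "ereal L \<le> ereal_of_enat (private_sample_complexity \<epsilon> U Q \<alpha>)"
proof -
  have "enat (nat \<lceil>L\<rceil>) \<le> private_sample_complexity \<epsilon> U Q \<alpha>"
    unfolding private_sample_complexity_def sample_complexity_def
    by (intro Inf_greatest) (auto intro!: Inf_greatest simp: nat_le_iff ceiling_le_iff assms)
  then have "ereal_of_enat (enat (nat \<lceil>L\<rceil>)) \<le> ereal_of_enat (private_sample_complexity \<epsilon> U Q \<alpha>)"
    by (simp only: ereal_of_enat_le_iff)
  moreover have "ereal L \<le> ereal_of_enat (enat (nat \<lceil>L\<rceil>))"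
    by (simp add: real_nat_ceiling_ge)
  ultimately show ?thesis by (rule order_trans[rotated])
qed

section \<open>Block datasets\<close>

abbreviation hamming :: "nat \<Rightarrow> (nat \<Rightarrow> nat) \<Rightarrow> (nat \<Rightarrow> nat) \<Rightarrow> nat" where
  "hamming s A A' \<equiv> card {i. i < s \<and> A i \<noteq> A' i}"

text \<open>The weight \<open>B\<^sup>-\<^sup>h\<close> of a function at distance \<open>h\<close> factorizes over the coordinates.\<close>

lemma card_hamming_ball_le:
  fixes A :: "nat \<Rightarrow> nat"
  assumes "1 \<le> B"
  shows "real (card {A' \<in> {..<s} \<rightarrow>\<^sub>E {..<B}. 4 * hamming s A A' < s})
    \<le> 2 ^ s * real B powr (s / 4)"
proof -
  let ?h = "hamming s A"
  let ?N = "{A' \<in> {..<s} \<rightarrow>\<^sub>E {..<B}. 4 * ?h A' < s}"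
  have fin: "finite ({..<s} \<rightarrow>\<^sub>E {..<B})" by (intro finite_PiE) auto
  have "real (card ?N) = (\<Sum>A'\<in>?N. 1)" by simp
  \<comment> \<open>Inside the ball the distance is at most s/4, so the rescaled weight is at least
    1.\<close>
  also have "\<dots> \<le> (\<Sum>A'\<in>?N. real B powr (s / 4) * (1 / B) ^ ?h A')"
  proof (rule sum_mono)
    fix A' assume "A' \<in> ?N"
    then have "real (?h A') \<le> s / 4" by simp
    then have "real B powr ?h A' \<le> real B powr (s / 4)"
      using assms by (intro powr_mono) auto
    then show "1 \<le> real B powr (s / 4) * (1 / B) ^ ?h A'"
      using assms by (simp add: powr_realpow field_simps)
  qed
  also have "\<dots> \<le> (\<Sum>A'\<in>{..<s} \<rightarrow>\<^sub>E {..<B}. real B powr (s / 4) * (1 / B) ^ ?h A')"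
    by (intro sum_mono2 fin) auto
  also have "\<dots> = real B powr (s / 4) *
      (\<Sum>A'\<in>{..<s} \<rightarrow>\<^sub>E {..<B}. \<Prod>i<s. if A i \<noteq> A' i then 1 / B else 1)"
  proof -
    have "(1 / real B) ^ ?h A' = (\<Prod>i<s. if A i \<noteq> A' i then 1 / B else 1)" for A'
      by (subst prod.inter_filter[symmetric]) (auto simp: lessThan_def)
    then show ?thesis by (simp add: sum_distrib_left)
  qed
  also have "\<dots> = real B powr (s / 4) * (\<Prod>i<s. \<Sum>b<B. if A i \<noteq> b then 1 / B else 1)"
    by (subst prod_sum_PiE) auto
  \<comment> \<open>In each coordinate at most one symbol agrees with \<open>A i\<close> and has
    weight 1; the others have total weight at most 1.\<close>
  also have "\<dots> \<le> real B powr (s / 4) * (\<Prod>i<s. 2)"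
  proof (intro mult_left_mono prod_mono conjI)
    fix i
    have "(\<Sum>b<B. if A i \<noteq> b then 1 / B else 1) \<le> (\<Sum>b<B. 1 / B + (if A i = b then 1 else 0))"
      by (intro sum_mono) auto
    also have "\<dots> = 1 + (if A i < B then 1 else 0)"
      using assms by (simp add: sum.distrib)
    also have "\<dots> \<le> (2 :: real)" by simp
    finally show "(\<Sum>b<B. if A i \<noteq> b then 1 / real B else 1) \<le> 2" .
  qed (auto intro: sum_nonneg)
  finally show ?thesis by (simp add: mult.commute)
qed

text \<open>The pair of a block \<open>i\<close> and a symbol \<open>b < B\<close> is encoded as the universe element
  \<open>i * B + b\<close>, and element \<open>0\<close> pads the dataset to size \<open>n\<close>.\<close>

definition block_dataset :: "nat \<Rightarrow> nat \<Rightarrow> nat \<Rightarrow> nat \<Rightarrow> (nat \<Rightarrow> nat) \<Rightarrow> nat list" where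
  "block_dataset n B s m A =
    replicate (n - s * m) 0 @ concat (map (\<lambda>i. replicate m (i * B + A i)) [0..<s])"

lemma length_block_dataset: "s * m \<le> n \<Longrightarrow> length (block_dataset n B s m A) = n"
  by (simp add: block_dataset_def length_concat comp_def sum_list_triv)

lemma block_index_less:
  fixes B :: nat
  assumes "i < S" "b < B"
  shows "i * B + b < S * B"
proof -
  have "i * B + b < Suc i * B" using assms(2) by simp
  also have "\<dots> \<le> S * B" using assms(1) by (intro mult_right_mono) auto
  finally show ?thesis .
qed

lemma block_dataset_in_datasets:
  assumes "s * m \<le> n" "A \<in> {..<s} \<rightarrow>\<^sub>E {..<B}" "s * B \<le> N" "1 \<le> N"
  shows "block_dataset n B s m A \<in> datasets {..<N} n"
proof -
  have "i * B + A i < N" if "i < s" for i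
    using block_index_less[OF that, of "A i" B] PiE_mem[OF assms(2), of i] that assms(3) by simp
  then have "set (block_dataset n B s m A) \<subseteq> {..<N}"
    using assms(4) by (auto simp: block_dataset_def)
  then show ?thesis
    using length_block_dataset[OF assms(1)] by (simp add: datasets_def)
qed

text \<open>The padding is a common prefix, so only the last \<open>s * m\<close> rows can
  differ.\<close>

lemma block_dataset_hamming:
  assumes "s * m \<le> n"
  shows "card {l. l < n \<and> block_dataset n B s m A ! l \<noteq> block_dataset n B s m A' ! l} \<le> s * m"
proof -
  have "{l. l < n \<and> block_dataset n B s m A ! l \<noteq> block_dataset n B s m A' ! l} \<subseteq> {n - s * m..<n}"
    by (auto simp: block_dataset_def nth_append not_less intro: leI)
  then have "card {l. l < n \<and> block_dataset n B s m A ! l \<noteq> block_dataset n B s m A' ! l}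
      \<le> card {n - s * m..<n}"
    by (intro card_mono) auto
  also have "\<dots> = s * m" using assms by simp
  finally show ?thesis .
qed

text \<open>The padding term does not depend on \<open>A\<close>, so it cancels when two block
  datasets are compared.\<close>

lemma query_value_block_dataset:
  assumes "s * m \<le> n"
  shows "query_value q (block_dataset n B s m A) =
    (real (n - s * m) * q 0 + real m * (\<Sum>i<s. q (i * B + A i))) / n"
proof -
  have "(\<Sum>x\<leftarrow>concat (map (\<lambda>i. replicate m (i * B + A i)) [0..<s]). q x) =
      real m * (\<Sum>i<s. q (i * B + A i))"
    by (induction s) (simp_all add: sum_list_replicate algebra_simps)
  then show ?thesis
    using length_block_dataset[OF assms, of B A]
    by (simp add: query_value_def block_dataset_def sum_list_replicate)
qed

section \<open>Separation of the answers on block datasets\<close>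

text \<open>Difference of the indicators of two choice functions. Extending it by zero to the blocks
  from \<open>s\<close> on puts the vectors for all \<open>s\<close> on one index set, so that a
  single sign matrix treats them together.\<close>

definition block_vector :: "nat \<Rightarrow> (nat \<Rightarrow> nat) \<Rightarrow> (nat \<Rightarrow> nat) \<Rightarrow> nat \<times> nat \<Rightarrow> real" where
  "block_vector s A A' = (\<lambda>(i, b). if i < s then of_bool (A i = b) - of_bool (A' i = b) else 0)"

lemma sum_block_vector:
  assumes "s \<le> S" "A \<in> {..<s} \<rightarrow>\<^sub>E {..<B}" "A' \<in> {..<s} \<rightarrow>\<^sub>E {..<B}"
  shows "(\<Sum>p\<in>{..<S} \<times> {..<B}. block_vector s A A' p * f p) = (\<Sum>i<s. f (i, A i) - f (i, A' i))"
    and "(\<Sum>p\<in>{..<S} \<times> {..<B}. (block_vector s A A' p)\<^sup>2) = 2 * real (hamming s A A')"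
proof -
  have less: "A i < B" "A' i < B" if "i < s" for i
    using PiE_mem[OF assms(2), of i] PiE_mem[OF assms(3), of i] that by auto
  have restrict: "(\<Sum>i<S. if i < s then g i else 0) = (\<Sum>i<s. g i :: real)" for g
    using assms(1) by (intro sum.mono_neutral_cong_right) auto
  have "(\<Sum>p\<in>{..<S} \<times> {..<B}. block_vector s A A' p * f p) =
      (\<Sum>i<S. if i < s then f (i, A i) - f (i, A' i) else 0)"
    unfolding sum.cartesian_product'
  proof (intro sum.cong refl)
    fix i
    have "(\<Sum>b<B. (of_bool (a = b) - of_bool (a' = b)) * f (i, b)) = f (i, a) - f (i, a')"
      if "a < B" "a' < B" for a a'
      using that by (simp add: algebra_simps sum_subtractf of_bool_def if_distrib[of "\<lambda>x. _ * x"] cong: if_cong)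
    then show "(\<Sum>b<B. block_vector s A A' (i, b) * f (i, b)) =
        (if i < s then f (i, A i) - f (i, A' i) else 0)"
      using less by (simp add: block_vector_def)
  qed
  then show "(\<Sum>p\<in>{..<S} \<times> {..<B}. block_vector s A A' p * f p) = (\<Sum>i<s. f (i, A i) - f (i, A' i))"
    by (simp add: restrict)
  have "(\<Sum>p\<in>{..<S} \<times> {..<B}. (block_vector s A A' p)\<^sup>2) =
      (\<Sum>i<S. if i < s then (if A i \<noteq> A' i then 2 else 0) else 0)"
    unfolding sum.cartesian_product'
  proof (intro sum.cong refl)
    fix i
    have "(\<Sum>b<B. (of_bool (a = b) - of_bool (a' = b))\<^sup>2) = (if a \<noteq> a' then 2 else 0 :: real)"
      if "a < B" "a' < B" for a a'
    proof -
      have "(of_bool (a = b) - of_bool (a' = b))\<^sup>2 =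
          (if a = b then of_bool (a \<noteq> a') else 0) + (if a' = b then of_bool (a \<noteq> a') else 0 :: real)" for b
        by auto
      then show ?thesis using that by (simp add: sum.distrib)
    qed
    then show "(\<Sum>b<B. (block_vector s A A' (i, b))\<^sup>2) =
        (if i < s then (if A i \<noteq> A' i then 2 else 0) else 0)"
      using less by (simp add: block_vector_def)
  qed
  also have "\<dots> = (\<Sum>i<s. if A i \<noteq> A' i then 2 else 0)" by (rule restrict)
  also have "\<dots> = (\<Sum>i\<in>{i. i < s \<and> A i \<noteq> A' i}. 2)"
    by (subst sum.inter_filter[symmetric]) (auto simp: lessThan_def)
  finally show "(\<Sum>p\<in>{..<S} \<times> {..<B}. (block_vector s A A' p)\<^sup>2) = 2 * real (hamming s A A')"
    by simp
qed

text \<open>The union bound runs over all \<open>s\<close> and all pairs of functions, at most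
  \<open>S * (B ^ S * B ^ S)\<close> vectors. The factor \<open>S\<close> is absorbed by a third
  \<open>B ^ S\<close>.\<close>

lemma exists_block_queries:
  assumes S: "1 \<le> S" and B: "2 \<le> B" and k: "80 * real S * ln B \<le> k"
  shows "\<exists>P :: nat \<Rightarrow> nat \<times> nat \<Rightarrow> real. (\<forall>j<k. \<forall>i<S. \<forall>b<B. \<bar>P j (i, b)\<bar> = 1) \<and>
    (\<forall>s\<in>{1..S}. \<forall>A\<in>{..<s} \<rightarrow>\<^sub>E {..<B}. \<forall>A'\<in>{..<s} \<rightarrow>\<^sub>E {..<B}. s \<le> 4 * hamming s A A' \<longrightarrow>
      real k * s / 8 < (\<Sum>j<k. (\<Sum>i<s. P j (i, A i) - P j (i, A' i))\<^sup>2))"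
proof -
  let ?F = "\<lambda>s. {..<s} \<rightarrow>\<^sub>E {..<B}"
  define T where "T = (SIGMA s:{1..S}. ?F s \<times> ?F s)"
  define T' where "T' = {(s, A, A') \<in> T. s \<le> 4 * hamming s A A'}"
  define Z where "Z = (\<lambda>(s, A, A'). block_vector s A A') ` T'"
  have finF: "finite (?F s)" for s :: nat by (intro finite_PiE) auto
  have fin: "finite T" unfolding T_def by (intro finite_SigmaI finite_cartesian_product finF) auto
  have T': "T' \<subseteq> T" by (auto simp: T'_def)
  have "card Z \<le> card T'" unfolding Z_def by (intro card_image_le finite_subset[OF T' fin])
  also have "\<dots> \<le> card T" by (intro card_mono fin T')
  also have "\<dots> = (\<Sum>s\<in>{1..S}. B ^ s * B ^ s)"
    unfolding T_def by (subst card_SigmaI) (auto simp: card_cartesian_product card_PiE finF)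
  also have "\<dots> \<le> (\<Sum>s\<in>{1..S}. B ^ S * B ^ S)"
    using B by (intro sum_mono mult_mono power_increasing) auto
  also have "\<dots> = S * (B ^ S * B ^ S)" by simp
  also have "\<dots> \<le> B ^ S * (B ^ S * B ^ S)"
  proof (intro mult_right_mono)
    have "S < 2 ^ S" by simp
    also have "\<dots> \<le> B ^ S" using B by (intro power_mono) auto
    finally show "S \<le> B ^ S" by simp
  qed simp
  also have "\<dots> = B ^ (3 * S)" by (simp add: power_mult power3_eq_cube power_mult_distrib)
  finally have "card Z \<le> B ^ (3 * S)" .
  then have "real (card Z) \<le> real (B ^ (3 * S))" by (rule of_nat_mono)
  also have "\<dots> = real B ^ (3 * S)" by simp
  also have "\<dots> = exp (3 * real S * ln B)"
    using B by (subst powr_realpow[symmetric]) (simp_all add: powr_def)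
  \<comment> \<open>The constant 80 in the hypothesis exceeds 3 * 24 = 72.\<close>
  also have "\<dots> < exp (real k / 24)"
  proof -
    have "0 < real S * ln B" using S B by simp
    then show ?thesis using k by simp
  qed
  finally have card_Z: "real (card Z) < exp (real k / 24)" .
  have finZ: "finite Z" unfolding Z_def by (intro finite_imageI finite_subset[OF T' fin])
  have "0 < (\<Sum>p\<in>{..<S} \<times> {..<B}. (z p)\<^sup>2)" if "z \<in> Z" for z
  proof -
    obtain s A A' where z: "z = block_vector s A A'" "(s, A, A') \<in> T'"
      using \<open>z \<in> Z\<close> by (auto simp: Z_def)
    then have "s \<le> S" "A \<in> ?F s" "A' \<in> ?F s" "1 \<le> s" "s \<le> 4 * hamming s A A'"
      by (simp_all add: T'_def T_def)
    then show ?thesis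
      using sum_block_vector(2)[of s S A B A'] by (simp add: z(1))
  qed
  from exists_sign_matrix[OF _ finZ this card_Z] obtain P :: "nat \<Rightarrow> nat \<times> nat \<Rightarrow> real" where
    P: "\<forall>j<k. \<forall>i\<in>{..<S} \<times> {..<B}. \<bar>P j i\<bar> = 1"
      "\<forall>z\<in>Z. real k / 4 * (\<Sum>p\<in>{..<S} \<times> {..<B}. (z p)\<^sup>2) <
        (\<Sum>j<k. (\<Sum>p\<in>{..<S} \<times> {..<B}. z p * P j p)\<^sup>2)"
    by auto
  have "real k * s / 8 < (\<Sum>j<k. (\<Sum>i<s. P j (i, A i) - P j (i, A' i))\<^sup>2)"
    if s: "s \<in> {1..S}" and A: "A \<in> ?F s" "A' \<in> ?F s" and far: "s \<le> 4 * hamming s A A'" for s A A'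
  proof -
    have "(s, A, A') \<in> T'" using that by (simp add: T'_def T_def)
    then have "block_vector s A A' \<in> Z" unfolding Z_def by (rule image_eqI[rotated]) simp
    from bspec[OF P(2) this] have "real k / 4 * (2 * real (hamming s A A')) <
        (\<Sum>j<k. (\<Sum>i<s. P j (i, A i) - P j (i, A' i))\<^sup>2)"
      using s A by (simp only: sum_block_vector[of s S A B A'] atLeastAtMost_iff)
    \<comment> \<open>Functions differing on a quarter of the blocks give a vector of squared norm
      at least s/2, and k/4 * s/2 = k s/8.\<close>
    moreover have "real k * s / 8 \<le> real k / 4 * (2 * real (hamming s A A'))"
    proof -
      have "real k * s \<le> real k * (4 * hamming s A A')" using far by (intro mult_left_mono) auto
      then show ?thesis by simp
    qed
    ultimately show ?thesis by simp
  qed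
  moreover have "\<forall>j<k. \<forall>i<S. \<forall>b<B. \<bar>P j (i, b)\<bar> = 1" using P(1) by simp
  ultimately show ?thesis by (intro exI[of _ P]) simp
qed

text \<open>Transfers the sign matrix to the encoded universe, with value 0 outside the blocks.
  Repeating each chosen element \<open>m\<close> times among \<open>n\<close> rows scales the
  separation by m/n.\<close>

lemma block_workload_exists:
  fixes S B k N :: nat
  assumes S: "1 \<le> S" and B: "2 \<le> B" and k: "80 * real S * ln B \<le> k" and N: "S * B \<le> N"
  shows "\<exists>Q. length Q = k \<and> bounded_workload {..<N} Q \<and>
    (\<forall>s\<in>{1..S}. \<forall>A\<in>{..<s} \<rightarrow>\<^sub>E {..<B}. \<forall>A'\<in>{..<s} \<rightarrow>\<^sub>E {..<B}. \<forall>n m. 1 \<le> n \<longrightarrow> s * m \<le> n \<longrightarrow> 1 \<le> m \<longrightarrow>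
      s \<le> 4 * hamming s A A' \<longrightarrow>
      real m / n * sqrt (real k * s / 8) <
        answer_dist Q (block_dataset n B s m A) (block_dataset n B s m A'))"
proof -
  from exists_block_queries[OF S B k] obtain P :: "nat \<Rightarrow> nat \<times> nat \<Rightarrow> real" where
    bounded: "\<forall>j<k. \<forall>i<S. \<forall>b<B. \<bar>P j (i, b)\<bar> = 1" and
    spread: "\<forall>s\<in>{1..S}. \<forall>A\<in>{..<s} \<rightarrow>\<^sub>E {..<B}. \<forall>A'\<in>{..<s} \<rightarrow>\<^sub>E {..<B}. s \<le> 4 * hamming s A A' \<longrightarrow>
      real k * s / 8 < (\<Sum>j<k. (\<Sum>i<s. P j (i, A i) - P j (i, A' i))\<^sup>2)"
    by (elim exE conjE)
  define q where "q j x = (if x < S * B then P j (x div B, x mod B) else 0)" for j x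
  have q: "q j (i * B + b) = P j (i, b)" if "i < S" "b < B" for j i b
    using block_index_less[OF that] that by (simp add: q_def)
  define Q where "Q = map q [0..<k]"
  have len: "length Q = k" and nth: "j < k \<Longrightarrow> Q ! j = q j" for j by (simp_all add: Q_def)
  have "bounded_workload {..<N} Q"
    unfolding bounded_workload_def
  proof safe
    fix f x assume "f \<in> set Q"
    then obtain j where j: "j < k" "f = q j" by (auto simp: Q_def)
    show "\<bar>f x\<bar> \<le> 1"
    proof (cases "x < S * B")
      case True
      then have "x div B < S" "x mod B < B" using B by (simp_all add: div_less_iff_less_mult)
      with bounded j True show ?thesis by (simp add: q_def)
    qed (simp add: q_def j(2))
  qed
  moreover have "real m / n * sqrt (real k * s / 8) <
      answer_dist Q (block_dataset n B s m A) (block_dataset n B s m A')"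
    if s: "s \<in> {1..S}" and A: "A \<in> {..<s} \<rightarrow>\<^sub>E {..<B}" "A' \<in> {..<s} \<rightarrow>\<^sub>E {..<B}"
      and n: "1 \<le> n" "s * m \<le> n" "1 \<le> m" and far: "s \<le> 4 * hamming s A A'" for s A A' n m
  proof -
    have sums: "(\<Sum>i<s. q j (i * B + A i)) - (\<Sum>i<s. q j (i * B + A' i)) =
        (\<Sum>i<s. P j (i, A i) - P j (i, A' i))" for j
      unfolding sum_subtractf[symmetric] using s PiE_mem[OF A(1)] PiE_mem[OF A(2)]
      by (intro sum.cong refl) (simp add: q)
    have "query_value (Q ! j) (block_dataset n B s m A) - query_value (Q ! j) (block_dataset n B s m A') =
        real m / n * (\<Sum>i<s. P j (i, A i) - P j (i, A' i))" if "j < k" for j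
      unfolding sums[symmetric] query_value_block_dataset[OF n(2)] nth[OF that]
      by (simp add: diff_divide_distrib add_divide_distrib algebra_simps)
    then have "answer_dist Q (block_dataset n B s m A) (block_dataset n B s m A') =
        L2_set (\<lambda>j. real m / n * (\<Sum>i<s. P j (i, A i) - P j (i, A' i))) {..<k}"
      unfolding answer_dist_def len by (intro L2_set_cong) auto
    also have "\<dots> = real m / n * L2_set (\<lambda>j. \<Sum>i<s. P j (i, A i) - P j (i, A' i)) {..<k}"
      by (simp only: L2_set_right_distrib[symmetric] of_nat_0_le_iff divide_nonneg_nonneg)
    finally have eq: "answer_dist Q (block_dataset n B s m A) (block_dataset n B s m A') =
        real m / n * L2_set (\<lambda>j. \<Sum>i<s. P j (i, A i) - P j (i, A' i)) {..<k}" .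
    have "sqrt (real k * s / 8) < L2_set (\<lambda>j. \<Sum>i<s. P j (i, A i) - P j (i, A' i)) {..<k}"
      using spread[rule_format, OF s A far] unfolding L2_set_def by (rule real_sqrt_less_mono)
    then show ?thesis unfolding eq using n by (intro mult_strict_left_mono) auto
  qed
  ultimately show ?thesis using len by blast
qed

text \<open>One workload serves all dataset sizes \<open>n\<close>: when \<open>n\<close> is too small for one element per block,
  only the first \<open>\<lceil>n / 2\<rceil>\<close> blocks are used.\<close>

lemma block_packing_bound:
  fixes S B k N :: nat and \<alpha> \<epsilon> :: real
  assumes S: "1 \<le> S" and B: "4 \<le> ln (real B)" and k: "80 * real S * ln B \<le> k" and N: "S * B \<le> N"
    and \<alpha>: "0 < \<alpha>" "46 * \<alpha> * sqrt S \<le> 1" and \<epsilon>: "0 < \<epsilon>" "\<epsilon> < 1"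
  shows "\<exists>Q. length Q = k \<and> bounded_workload {..<N} Q \<and>
    (\<forall>M n. mechanism {..<N} k M \<longrightarrow> diff_private \<epsilon> {..<N} k M \<longrightarrow> 1 \<le> n \<longrightarrow>
      err {..<N} M Q n \<le> ennreal \<alpha> \<longrightarrow> sqrt S * ln B \<le> 92 * \<epsilon> * \<alpha> * n)"
proof -
  have B2: "2 \<le> B"
  proof (rule ccontr)
    assume "\<not> 2 \<le> B"
    then have "B = 0 \<or> B = 1" by auto
    then show False using B by auto
  qed
  from block_workload_exists[OF S B2 k N] obtain Q where Q: "length Q = k" "bounded_workload {..<N} Q"
    and sep: "\<forall>s\<in>{1..S}. \<forall>A\<in>{..<s} \<rightarrow>\<^sub>E {..<B}. \<forall>A'\<in>{..<s} \<rightarrow>\<^sub>E {..<B}. \<forall>n m.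
      1 \<le> n \<longrightarrow> s * m \<le> n \<longrightarrow> 1 \<le> m \<longrightarrow> s \<le> 4 * hamming s A A' \<longrightarrow>
      real m / n * sqrt (real k * s / 8) <
        answer_dist Q (block_dataset n B s m A) (block_dataset n B s m A')"
    by (elim exE conjE)
  have k1: "1 \<le> k"
  proof -
    have "0 < 80 * real S * ln B" using S B by simp
    then show ?thesis using k by linarith
  qed
  have N1: "1 \<le> N" using N S B2 by (cases N) auto
  have "sqrt S * ln B \<le> 92 * \<epsilon> * \<alpha> * n"
    if M: "mechanism {..<N} k M" and dp: "diff_private \<epsilon> {..<N} k M" and n: "1 \<le> n"
      and err: "err {..<N} M Q n \<le> ennreal \<alpha>" for M n
  proof -
    \<comment> \<open>The hypothesis \<open>scale\<close> makes the separation reach the packing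
      threshold, because 8 * sqrt 8 \<le> 23.\<close>
    have main: "3 / 4 * ln B \<le> \<epsilon> * m + 1"
      if s: "s \<in> {1..S}" and m: "1 \<le> m" "s * m \<le> n" and scale: "23 * \<alpha> * n \<le> m * sqrt s" for s m
    proof -
      let ?F = "{..<s} \<rightarrow>\<^sub>E {..<B}" and ?D = "block_dataset n B s m"
      let ?V = "2 ^ s * real B powr (s / 4)"
      have finF: "finite ?F" by (intro finite_PiE) auto
      have sB: "s * B \<le> N" using s by (intro order_trans[OF mult_right_mono N]) auto
      have thr: "8 * \<alpha> * sqrt k \<le> real m / n * sqrt (real k * s / 8)"
      proof -
        have "sqrt 8 \<le> 23 / 8" by (rule real_le_lsqrt) (auto simp: power2_eq_square)
        then have "8 * \<alpha> * n * sqrt 8 \<le> 8 * \<alpha> * n * (23 / 8)" using \<alpha> by (intro mult_left_mono) auto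
        also have "\<dots> \<le> m * sqrt s" using scale by simp
        finally have "8 * \<alpha> \<le> real m / n * sqrt (s / 8)"
          using n by (simp add: real_sqrt_divide field_simps)
        then have "8 * \<alpha> * sqrt k \<le> real m / n * sqrt (s / 8) * sqrt k"
          by (intro mult_right_mono) auto
        also have "\<dots> = real m / n * sqrt (real k * s / 8)"
          by (simp add: real_sqrt_mult real_sqrt_divide)
        finally show ?thesis .
      qed
      have "3 / 4 * real (card ?F) \<le> exp (\<epsilon> * (s * m)) * ?V"
      proof (rule packing_bound[OF _ _ err \<alpha>(1) _ _ finF])
        show "mechanism {..<N} (length Q) M" "diff_private \<epsilon> {..<N} (length Q) M" "0 \<le> \<epsilon>" "Q \<noteq> []"
          using M dp \<epsilon> Q(1) k1 by auto
        show "?D A \<in> datasets {..<N} n" if "A \<in> ?F" for A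
          using block_dataset_in_datasets[OF m(2) that sB N1] .
        show "card {l. l < n \<and> ?D A ! l \<noteq> ?D A' ! l} \<le> s * m" for A A'
          using block_dataset_hamming[OF m(2)] .
        show "0 \<le> ?V" by simp
        fix A assume A: "A \<in> ?F"
        have "{A' \<in> ?F. answer_dist Q (?D A) (?D A') \<le> 8 * \<alpha> * sqrt (length Q)} \<subseteq>
            {A' \<in> ?F. 4 * hamming s A A' < s}"
        proof safe
          fix A' assume A': "A' \<in> ?F" and near: "answer_dist Q (?D A) (?D A') \<le> 8 * \<alpha> * sqrt (length Q)"
          show "4 * hamming s A A' < s"
          proof (rule ccontr)
            assume "\<not> ?thesis"
            then have "real m / n * sqrt (real k * s / 8) < answer_dist Q (?D A) (?D A')"
              using sep[rule_format, OF s A A' n m(2,1)] by simp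
            then show False using thr near Q(1) by simp
          qed
        qed
        then have "card {A' \<in> ?F. answer_dist Q (?D A) (?D A') \<le> 8 * \<alpha> * sqrt (length Q)} \<le>
            card {A' \<in> ?F. 4 * hamming s A A' < s}"
          by (intro card_mono finite_subset[OF _ finF]) auto
        also have "real \<dots> \<le> ?V" using B2 by (intro card_hamming_ball_le) auto
        finally show "real (card {A' \<in> ?F. answer_dist Q (?D A) (?D A') \<le> 8 * \<alpha> * sqrt (length Q)}) \<le> ?V"
          by simp
      qed
      also have "card ?F = B ^ s" by (simp add: card_PiE)
      \<comment> \<open>Both the row distance \<open>s * m\<close> and the logarithm of the ball
        size are proportional to \<open>s\<close>. After taking logarithms and using s \<ge> 1 for
        the constant, \<open>s\<close> cancels.\<close>
      finally have "3 / 4 * exp (s * ln B) \<le> exp (\<epsilon> * (s * m)) * (exp (s * ln 2) * exp (s / 4 * ln B))"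
        using B2 by (simp add: exp_of_nat_mult powr_def)
      also have "\<dots> = exp (\<epsilon> * (s * m) + s * ln 2 + s / 4 * ln B)"
        by (simp add: exp_add)
      finally have "exp (s * ln B) \<le> 4 / 3 * exp (\<epsilon> * (s * m) + s * ln 2 + s / 4 * ln B)" by simp
      also have "\<dots> = exp (ln (4 / 3) + (\<epsilon> * (s * m) + s * ln 2 + s / 4 * ln B))"
        unfolding exp_add[of "ln (4/3)"] by simp
      finally have "s * ln B \<le> ln (4 / 3) + (\<epsilon> * (s * m) + s * ln 2 + s / 4 * ln B)" by simp
      also have "ln (4 / 3 :: real) \<le> s * ln (4 / 3)"
        using s mult_right_mono[of 1 "real s" "ln (4 / 3)"] by simp
      finally have "s * (3 / 4 * ln B) \<le> s * (\<epsilon> * m + (ln 2 + ln (4 / 3)))"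
        by (simp add: algebra_simps)
      then have "3 / 4 * ln B \<le> \<epsilon> * m + (ln 2 + ln (4 / 3))"
        using s by (subst (asm) mult_le_cancel_left_pos) auto
      \<comment> \<open>This is 8/3 \<le> e, obtained from the quadratic Taylor bound at 1/4 raised
        to the fourth power.\<close>
      also have "ln 2 + ln (4 / 3) \<le> (1 :: real)"
      proof -
        have "ln 2 + ln (4 / 3) = ln (8 / 3 :: real)" using ln_mult[of 2 "4 / 3 :: real"] by simp
        also have "\<dots> \<le> ln (exp (1 / 4) ^ 4)"
        proof (rule ln_mono)
          have "8 / 3 \<le> (1 + 1 / 4 + (1 / 4)\<^sup>2 / 2 :: real) ^ 4"
            by (simp add: power2_eq_square power4_eq_xxxx)
          also have "\<dots> \<le> exp (1 / 4) ^ 4"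
            using exp_lower_Taylor_quadratic[of "1 / 4 :: real"] by (intro power_mono) auto
          finally show "8 / 3 \<le> exp (1 / 4 :: real) ^ 4" .
        qed auto
        also have "\<dots> = 1" by (simp add: ln_realpow)
        finally show ?thesis .
      qed
      finally show ?thesis by simp
    qed
    show ?thesis
    proof (cases "n < 2 * S")
      case True
      \<comment> \<open>Rounding up gives s \<le> S and n \<le> 2 s, so multiplicity 1 already
        separates. Then 3/4 ln B \<le> \<epsilon> + 1 < 2 contradicts ln B \<ge> 4: no such
        \<open>n\<close> is possible.\<close>
      define s where "s = (n + 1) div 2"
      have s: "s \<in> {1..S}" "s \<le> n" "n \<le> 2 * s" using True n by (auto simp: s_def)
      have "23 * \<alpha> * n \<le> 23 * \<alpha> * (2 * s)" using s(3) \<alpha> by (intro mult_left_mono) auto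
      also have "\<dots> = 46 * \<alpha> * sqrt s * sqrt s" by simp
      also have "\<dots> \<le> 46 * \<alpha> * sqrt S * sqrt s"
        using s(1) \<alpha> by (intro mult_right_mono mult_left_mono) auto
      also have "\<dots> \<le> 1 * sqrt s" using \<alpha> by (intro mult_right_mono) auto
      finally have "3 / 4 * ln B \<le> \<epsilon> * 1 + 1" using main[OF s(1), of 1] s by simp
      then have False using B \<epsilon> by simp
      then show ?thesis ..
    next
      case False
      \<comment> \<open>The least real multiplicity satisfying \<open>scale\<close>. Rounded up, the
        \<open>S\<close> blocks still fit: 23 \<alpha> n sqrt S and the rounding loss
        \<open>S\<close> are each at most n/2.\<close>
      define x where "x = 23 * \<alpha> * n / sqrt S"
      define m where "m = nat \<lceil>x\<rceil>"
      have sqS: "0 < sqrt S" "sqrt S * sqrt S = S" using S by auto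
      have x0: "0 < x" using \<alpha> n sqS by (simp add: x_def)
      have m: "1 \<le> m" "x \<le> m" "m \<le> x + 1" using x0 by (simp_all add: m_def) linarith+
      have "S * m \<le> real S * (x + 1)" using m(3) by (simp add: mult_left_mono del: distrib_left)
      also have "\<dots> = 23 * \<alpha> * n * sqrt S + S"
        using sqS by (simp add: x_def field_simps)
      also have "\<dots> \<le> n"
      proof -
        have "46 * \<alpha> * sqrt S * n \<le> 1 * real n" using \<alpha> by (intro mult_right_mono) auto
        then show ?thesis using False by (simp add: algebra_simps)
      qed
      finally have "S * m \<le> n" by (metis of_nat_le_iff of_nat_mult)
      moreover have "23 * \<alpha> * n \<le> m * sqrt S"
        using m(2) sqS by (simp add: x_def field_simps)
      ultimately have "3 / 4 * ln B \<le> \<epsilon> * m + 1" using main[of S m] S m(1) by simp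
      also have "\<epsilon> * m \<le> \<epsilon> * (x + 1)" using m(3) \<epsilon> by (intro mult_left_mono) auto
      finally have "3 / 4 * ln B \<le> \<epsilon> * x + 2" using \<epsilon> by (simp add: algebra_simps)
      \<comment> \<open>The additive 2 is at most half of ln B, leaving ln B / 4 on the
        left.\<close>
      then have "ln B \<le> 4 * (\<epsilon> * x)" using B by simp
      then have "ln B * sqrt S \<le> 4 * (\<epsilon> * x) * sqrt S" using sqS by simp
      also have "\<dots> = 92 * \<epsilon> * \<alpha> * n" using sqS by (simp add: x_def)
      finally show ?thesis by (simp add: mult.commute)
    qed
  qed
  then show ?thesis using Q by blast
qed

section \<open>Choice of parameters\<close>

text \<open>Random signs need many queries; for bounded \<open>k\<close>, twelve evenly spaced answers suffice.\<close>

lemma constant_workload_bound: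
  fixes k N :: nat and \<alpha> \<epsilon> :: real
  assumes N: "12 \<le> N" and k: "1 \<le> k" and \<alpha>: "0 < \<alpha>" "88 * \<alpha> \<le> 1" and \<epsilon>: "0 < \<epsilon>" "\<epsilon> < 1"
  shows "\<exists>Q. length Q = k \<and> bounded_workload {..<N} Q \<and>
    (\<forall>M n. mechanism {..<N} k M \<longrightarrow> diff_private \<epsilon> {..<N} k M \<longrightarrow> 1 \<le> n \<longrightarrow>
      err {..<N} M Q n \<le> ennreal \<alpha> \<longrightarrow> 1 \<le> 44 * \<epsilon> * \<alpha> * n)"
proof -
  \<comment> \<open>Twelve values from -1 to 1 with gap 2/11.\<close>
  define q :: "nat \<Rightarrow> real" where "q x = (if x < 12 then real x * (2 / 11) - 1 else 0)" for x
  define Q where "Q = replicate k q"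
  have len: "length Q = k" by (simp add: Q_def)
  have "bounded_workload {..<N} Q"
    by (auto simp: bounded_workload_def Q_def q_def abs_le_iff)
  moreover have "1 \<le> 44 * \<epsilon> * \<alpha> * n"
    if M: "mechanism {..<N} k M" and dp: "diff_private \<epsilon> {..<N} k M" and n: "1 \<le> n"
      and err: "err {..<N} M Q n \<le> ennreal \<alpha>" for M n
  proof -
    \<comment> \<open>The least integer strictly above 44 \<alpha> n. As 44 * 2/11 = 8, distinct
      answers are then farther apart than the packing threshold.\<close>
    define d where "d = nat \<lfloor>44 * \<alpha> * n\<rfloor> + 1"
    have x0: "0 \<le> 44 * \<alpha> * n" using \<alpha> by simp
    have d: "44 * \<alpha> * n < d" "d \<le> 44 * \<alpha> * n + 1"
      using x0 unfolding d_def by linarith+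
    \<comment> \<open>The bound n/2 + 1 \<le> n fails at n = 1, where \<open>d\<close> is 1
      directly.\<close>
    have dn: "d \<le> n"
    proof (cases "n = 1")
      case True
      have "\<lfloor>44 * \<alpha>\<rfloor> = 0" using \<alpha> by (simp add: floor_eq_iff)
      then show ?thesis using True by (simp add: d_def)
    next
      case False
      have "88 * \<alpha> * n \<le> 1 * real n" using \<alpha> by (intro mult_right_mono) auto
      then have "real d \<le> n / 2 + 1" using d(2) by simp
      also have "\<dots> \<le> n" using False n by simp
      finally show ?thesis by simp
    qed
    define X where "X j = replicate (n - d) 0 @ replicate d j" for j :: nat
    have X: "X j \<in> datasets {..<N} n" if "j < 12" for j
      using that dn N by (auto simp: X_def datasets_def)
    have ham: "card {l. l < n \<and> X i ! l \<noteq> X j ! l} \<le> d" for i j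
    proof -
      have "{l. l < n \<and> X i ! l \<noteq> X j ! l} \<subseteq> {n - d..<n}"
        by (auto simp: X_def nth_append intro: leI)
      then have "card {l. l < n \<and> X i ! l \<noteq> X j ! l} \<le> card {n - d..<n}" by (intro card_mono) auto
      then show ?thesis using dn by simp
    qed
    have dist: "answer_dist Q (X i) (X j) = sqrt k * (real d / n * (2 / 11) * \<bar>real i - real j\<bar>)"
      if "i < 12" "j < 12" for i j
    proof -
      have "query_value q (X i) - query_value q (X j) = real d / n * (q i - q j)"
        using dn by (simp add: query_value_def X_def sum_list_replicate algebra_simps flip: diff_divide_distrib)
      also have "q i - q j = 2 / 11 * (real i - real j)"
        using that by (simp add: q_def algebra_simps)
      finally have "query_value q (X i) - query_value q (X j) = real d / n * (2 / 11) * (real i - real j)"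
        by simp
      then have "answer_dist Q (X i) (X j) = L2_set (\<lambda>_. real d / n * (2 / 11) * (real i - real j)) {..<k}"
        unfolding answer_dist_def len by (intro L2_set_cong) (simp_all add: Q_def)
      then show ?thesis by (simp add: L2_set_constant abs_mult)
    qed
    \<comment> \<open>Twelve datasets give 3/4 * 12 = 9 \<ge> exp 2, hence \<epsilon> d \<ge> 2; one
      unit pays for the rounding in \<open>d\<close>.\<close>
    have "3 / 4 * real (card {..<12::nat}) \<le> exp (\<epsilon> * d) * 1"
    proof (rule packing_bound[OF _ _ err \<alpha>(1), where X = X])
      fix i :: nat assume i: "i \<in> {..<12}"
      have "{j \<in> {..<12}. answer_dist Q (X i) (X j) \<le> 8 * \<alpha> * sqrt (length Q)} \<subseteq> {i}"
      proof safe
        fix j :: nat assume j: "j < 12" and near: "answer_dist Q (X i) (X j) \<le> 8 * \<alpha> * sqrt (length Q)"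
        show "j = i"
        proof (rule ccontr)
          assume "j \<noteq> i"
          then have ij: "1 \<le> \<bar>real i - real j\<bar>" by linarith
          have "8 * \<alpha> < real d / n * (2 / 11)" using d(1) n by (simp add: field_simps)
          also have "\<dots> \<le> real d / n * (2 / 11) * \<bar>real i - real j\<bar>"
            using mult_left_mono[OF ij, of "real d / n * (2 / 11)"] by simp
          finally have "sqrt k * (8 * \<alpha>) < answer_dist Q (X i) (X j)"
            using dist[of i j] i j k by (simp only: lessThan_iff) (intro mult_strict_left_mono, auto)
          then show False using near len by (simp add: mult.commute)
        qed
      qed
      then have "card {j \<in> {..<12}. answer_dist Q (X i) (X j) \<le> 8 * \<alpha> * sqrt (length Q)} \<le> card {i}"
        by (intro card_mono) auto
      then show "real (card {j \<in> {..<12}. answer_dist Q (X i) (X j) \<le> 8 * \<alpha> * sqrt (length Q)}) \<le> 1"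
        by simp
    qed (use M dp \<epsilon> k len X ham in auto)
    then have "exp 1 * exp 1 \<le> exp (\<epsilon> * d)"
      using mult_mono[OF exp_le exp_le] by simp
    then have "2 \<le> \<epsilon> * d" by (simp flip: exp_add)
    also have "\<dots> \<le> \<epsilon> * (44 * \<alpha> * n + 1)" using d(2) \<epsilon> by (intro mult_left_mono) auto
    finally show ?thesis using \<epsilon> by (simp add: algebra_simps)
  qed
  ultimately show ?thesis using len by (intro exI[of _ Q]) simp
qed

lemma ln_8000_ge: "8 \<le> ln (8000 :: real)"
proof -
  have "exp 8 = (exp 1 :: real) ^ (8::nat)" by (simp flip: exp_of_nat_mult)
  also have "\<dots> \<le> (3 :: real) ^ 8" using exp_le by (intro power_mono) auto
  finally show ?thesis by (subst ln_ge_iff) auto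
qed

text \<open>Rounding exp \<mu> down to an integer block size costs at most half of the logarithm,
  since exp (\<mu>/2) \<le> exp \<mu> - 1.\<close>

lemma floor_exp_bounds:
  fixes \<mu> :: real
  assumes "8 \<le> \<mu>"
  shows "\<exists>B::nat. 0 < B \<and> \<mu> / 2 \<le> ln B \<and> ln B \<le> \<mu> \<and> real B \<le> exp \<mu>"
proof -
  define t where "t = exp (\<mu> / 2)"
  have t: "2 \<le> t" using assms exp_ge_add_one_self[of "\<mu> / 2"] unfolding t_def by linarith
  have tt: "exp \<mu> = t * t" by (simp add: t_def flip: exp_add)
  define B where "B = nat \<lfloor>exp \<mu>\<rfloor>"
  have B: "real B \<le> exp \<mu>" "exp \<mu> - 1 \<le> B"
    by (simp_all add: B_def)
  have "t \<le> t * t - 1"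
  proof -
    have "2 * t \<le> t * t" using t by (intro mult_right_mono) auto
    then show ?thesis using t by linarith
  qed
  then have "t \<le> B" using B tt by simp
  then have "ln t \<le> ln B" using t by (intro ln_mono) auto
  moreover have "ln B \<le> ln (exp \<mu>)" using B(1) \<open>t \<le> B\<close> t by (intro ln_mono) auto
  ultimately show ?thesis using B(1) \<open>t \<le> B\<close> t by (intro exI[of _ B]) (auto simp: t_def)
qed

text \<open>\<open>S\<close> is \<open>k / ln (N / k)\<close> up to a constant, clipped to the range from \<open>1\<close> to \<open>1 / \<alpha>\<^sup>2\<close>;
  the unclipped case and the two clippings produce the three terms of the minimum.\<close>

lemma block_count_exists:
  fixes k N :: nat and \<alpha> :: real
  assumes \<alpha>: "0 < \<alpha>" "\<alpha> \<le> 1 / 46" and k: "16000 \<le> k" and kN: "2 * k \<le> N"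
    and N: "2 / \<alpha>\<^sup>2 \<le> N"
  defines "L \<equiv> min (real k) (min (sqrt (real k * ln (N / k))) (ln (\<alpha>\<^sup>2 * N) / \<alpha>))"
  shows "\<exists>S::nat. 1 \<le> S \<and> 46 * \<alpha> * sqrt S \<le> 1 \<and> 8 \<le> ln (N / S) \<and> 8 \<le> k / (80 * S) \<and>
    L \<le> 2000 * (sqrt S * ln (N / S)) \<and> L \<le> 2000 * (sqrt S * (k / (80 * S)))"
proof -
  define x where "x = ln (real N / k)"
  \<comment> \<open>The shift keeps \<open>l\<close> at least 8 even when N/k is close to 2. It is
    affordable: S \<le> k / (1000 l) \<le> k/8000 makes ln (N/S) at least x + ln 8000.\<close>
  define l where "l = x + 8"
  define r where "r = min (k / (1000 * l)) (1 / (46 * \<alpha>)\<^sup>2)"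
  have k0: "0 < real k" using k by simp
  have N0: "0 < real N" using k kN by simp
  have x0: "0 \<le> x" unfolding x_def using kN k0 by (intro ln_ge_zero) (simp add: field_simps)
  have l8: "8 \<le> l" using x0 by (simp add: l_def)
  have L: "L \<le> k" "L \<le> sqrt (k * x)" "L \<le> ln (\<alpha>\<^sup>2 * N) / \<alpha>" by (auto simp: L_def x_def)
  show ?thesis
  proof (cases "r < 1")
    \<comment> \<open>Only the first entry of \<open>r\<close> can be below 1. Then k < 1000 x +
      8000, and k \<ge> 16000 turns this into k \<le> 2000 x, so one block yields the first term of
      the minimum.\<close>
    case True
    have "46 * \<alpha> \<le> 1" using \<alpha> by simp
    then have "(46 * \<alpha>)\<^sup>2 \<le> 1" using \<alpha> by (intro power_le_one) auto
    then have "1 \<le> 1 / (46 * \<alpha>)\<^sup>2" using \<alpha> by simp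
    then have "k / (1000 * l) < 1" using True by (auto simp: r_def)
    then have "k < 1000 * l" using l8 by simp
    then have kx: "real k \<le> 2000 * x" using k by (simp add: l_def)
    have "x \<le> ln N" unfolding x_def using k0 N0 k by (intro ln_mono) (auto simp: field_simps)
    then have "k \<le> 2000 * ln N" using kx by simp
    then show ?thesis using L(1) k \<open>46 * \<alpha> \<le> 1\<close> by (intro exI[of _ 1]) simp
  next
    case False
    define S where "S = nat \<lfloor>r\<rfloor>"
    have S: "1 \<le> S" "S \<le> r" "r \<le> 2 * S" 
    proof -
      have "1 \<le> \<lfloor>r\<rfloor>" using False by simp
      moreover from this have "real S = of_int \<lfloor>r\<rfloor>" by (simp add: S_def)
      ultimately show "1 \<le> S" "S \<le> r" "r \<le> 2 * S" by linarith+
    qed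
    have S0: "0 < real S" "0 < sqrt S" using S(1) by auto
    have Sk: "1000 * l * S \<le> k" using S(2) l8 by (auto simp: r_def field_simps)
    have Sa: "S \<le> 1 / (46 * \<alpha>)\<^sup>2" using S(2) by (simp add: r_def)
    then have Sa': "(46 * \<alpha>)\<^sup>2 * S \<le> 1" using \<alpha> by (simp add: field_simps)
    have "sqrt ((46 * \<alpha>)\<^sup>2 * S) \<le> sqrt 1" using Sa' by (rule real_sqrt_le_mono)
    then have c: "46 * \<alpha> * sqrt S \<le> 1" using \<alpha> by (simp add: real_sqrt_mult)
    have lnNS: "l \<le> ln (N / S)"
    proof -
      have "l \<le> x + ln 8000" using ln_8000_ge by (simp add: l_def)
      also have "\<dots> = ln (N / k * 8000)" using k0 N0 ln_mult[of "N / k" 8000] by (simp add: x_def)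
      also have "\<dots> \<le> ln (N / S)"
      proof (rule ln_mono)
        have "8000 * real S \<le> 1000 * l * S" using l8 S0 by simp
        then have "8000 * real S \<le> k" using Sk by linarith
        then have "real N * (8000 * S) \<le> real N * k" by (intro mult_left_mono) auto
        then show "N / k * 8000 \<le> real N / S" using k0 S0 by (simp add: field_simps)
      qed (use k0 N0 S0 in auto)
      finally show ?thesis .
    qed
    have kS: "l \<le> k / (80 * S)"
    proof -
      have "l * (80 * S) \<le> 1000 * l * S" using l8 S0 by simp
      then show ?thesis using Sk S0 by (simp add: field_simps)
    qed
    have two: "sqrt (k * x) \<le> 2000 * (sqrt S * (k / (80 * S)))"
    proof -
      have "k * x * S \<le> k * (1000 * l * S)" using x0 k0 S0 l8 by (simp add: l_def)
      also have "\<dots> \<le> real k * k" using Sk k0 by (intro mult_left_mono) auto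
      finally have "sqrt (k * x * S) \<le> sqrt (real k * k)" by (rule real_sqrt_le_mono)
      then have "sqrt (k * x) * sqrt S \<le> k" by (simp add: real_sqrt_mult)
      then have "sqrt (k * x) \<le> k / sqrt S" using S0 by (simp add: field_simps)
      also have "\<dots> = sqrt S * (k / S)" using S0 by (simp add: field_simps)
      also have "\<dots> \<le> 2000 * (sqrt S * (k / (80 * S)))" using S0 k0 by (simp add: field_simps)
      finally show ?thesis .
    qed
    \<comment> \<open>Which entry attains \<open>r\<close> decides which term is used: the square
      root if \<open>r\<close> is k / (1000 l), the logarithm over \<alpha> if it is the
      cap.\<close>
    have one: "L \<le> 2000 * (sqrt S * ln (N / S))"
    proof (cases "r = k / (1000 * l)")
      case True
      have "k \<le> 2000 * l * S" using S(3) l8 by (simp add: True field_simps)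
      then have "k * x \<le> 2000 * l * S * l" using x0 l8 S0 by (intro mult_mono) (auto simp: l_def)
      also have "\<dots> \<le> 2000 * (2000 * l * S * l)" using l8 by simp
      also have "\<dots> = (2000 * (sqrt S * l))\<^sup>2" by (simp add: power2_eq_square)
      finally have "sqrt (k * x) \<le> 2000 * (sqrt S * l)"
        using l8 by (intro real_le_lsqrt) (auto simp: x0)
      also have "\<dots> \<le> 2000 * (sqrt S * ln (N / S))" using lnNS by (intro mult_left_mono) auto
      finally show ?thesis using L(2) by simp
    next
      case False
      then have r: "r = 1 / (46 * \<alpha>)\<^sup>2" by (auto simp: r_def min_def split: if_splits)
      have "1 \<le> (2 * S) * (46 * \<alpha>)\<^sup>2" using S(3) \<alpha> unfolding r by (simp add: field_simps)
      \<comment> \<open>Here 2 * 46^2 = 4232 \<le> 4356 = 66^2.\<close>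
      also have "\<dots> \<le> (66 * \<alpha>)\<^sup>2 * S" using S0 by (simp add: power2_eq_square)
      finally have "sqrt 1 \<le> sqrt ((66 * \<alpha>)\<^sup>2 * S)" by (rule real_sqrt_le_mono)
      then have aS: "1 / \<alpha> \<le> 66 * sqrt S" using \<alpha> by (simp add: real_sqrt_mult field_simps)
      have aN: "2 \<le> \<alpha>\<^sup>2 * N" using N \<alpha> by (simp add: field_simps)
      have "ln (\<alpha>\<^sup>2 * N) / \<alpha> = ln (\<alpha>\<^sup>2 * N) * (1 / \<alpha>)" by simp
      also have "\<dots> \<le> ln (\<alpha>\<^sup>2 * N) * (66 * sqrt S)" using aS aN by (intro mult_left_mono) auto
      also have "\<dots> \<le> ln (N / S) * (66 * sqrt S)"
      proof (intro mult_right_mono ln_mono)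
        have "\<alpha>\<^sup>2 * S \<le> (46 * \<alpha>)\<^sup>2 * S"
          by (intro mult_right_mono) (simp_all add: power_mult_distrib)
        then have "real N * (\<alpha>\<^sup>2 * S) \<le> real N * 1" using Sa' by (intro mult_left_mono) auto
        then show "\<alpha>\<^sup>2 * N \<le> real N / S" using S0 by (simp add: field_simps)
      qed (use \<alpha> N0 S0 in auto)
      also have "\<dots> \<le> 2000 * (sqrt S * ln (N / S))" using lnNS l8 S0 by simp
      finally show ?thesis using L(3) by simp
    qed
    show ?thesis
      using S(1) c lnNS kS l8 one two L(2) by (intro exI[of _ S]) auto
  qed
qed

section \<open>Combining large and bounded numbers of queries\<close>

theorem theorem8:
  "\<exists>c>0. \<exists>c'>0. \<forall>(\<alpha>::real) (\<epsilon>::real) (k::nat) (N::nat).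
     0 < \<alpha> \<and> \<alpha> < c \<and> 0 < \<epsilon> \<and> \<epsilon> < 1 \<and> 1 \<le> k \<and>
     real k \<le> 1 / 2 * real N \<and> real N \<ge> 2 / \<alpha>\<^sup>2 \<longrightarrow>
     (\<exists>(U::nat set) Q. finite U \<and> card U = N \<and> length Q = k \<and> bounded_workload U Q \<and>
        ereal_of_enat (private_sample_complexity \<epsilon> U Q \<alpha>) \<ge>
          ereal (c' * Min {real k / (\<epsilon> * \<alpha>),
                           sqrt (real k * ln (real N / real k)) / (\<epsilon> * \<alpha>),
                           ln (\<alpha>\<^sup>2 * real N) / (\<epsilon> * \<alpha>\<^sup>2)}))"
proof (rule exI[of _ "1 / 1000"], intro conjI, simp, rule exI[of _ "1 / 1000000"], intro conjI allI impI, simp)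
  fix \<alpha> \<epsilon> :: real and k N :: nat
  assume *: "0 < \<alpha> \<and> \<alpha> < 1 / 1000 \<and> 0 < \<epsilon> \<and> \<epsilon> < 1 \<and> 1 \<le> k \<and>
    real k \<le> 1 / 2 * real N \<and> real N \<ge> 2 / \<alpha>\<^sup>2"
  define L where "L = Min {real k / (\<epsilon> * \<alpha>), sqrt (real k * ln (real N / real k)) / (\<epsilon> * \<alpha>),
    ln (\<alpha>\<^sup>2 * real N) / (\<epsilon> * \<alpha>\<^sup>2)}"
  have \<epsilon>\<alpha>: "0 < \<epsilon> * \<alpha>" using * by simp
  have "L \<le> real k / (\<epsilon> * \<alpha>)" "L \<le> sqrt (real k * ln (real N / real k)) / (\<epsilon> * \<alpha>)"
    "L \<le> ln (\<alpha>\<^sup>2 * real N) / \<alpha> / (\<epsilon> * \<alpha>)"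
    by (simp_all add: L_def power2_eq_square mult.assoc mult.left_commute)
  then have L: "L * (\<epsilon> * \<alpha>) \<le> real k" "L * (\<epsilon> * \<alpha>) \<le> sqrt (real k * ln (real N / real k))"
    "L * (\<epsilon> * \<alpha>) \<le> ln (\<alpha>\<^sup>2 * real N) / \<alpha>"
    using \<epsilon>\<alpha> by (simp_all only: pos_le_divide_eq)
  \<comment> \<open>The workload is fixed before \<open>M\<close> and \<open>n\<close>. One million
    covers 4000 * 92 for large \<open>k\<close> and 16000 * 44 for bounded \<open>k\<close>.\<close>
  have "\<exists>Q. length Q = k \<and> bounded_workload {..<N} Q \<and>
    (\<forall>M n. mechanism {..<N} k M \<longrightarrow> diff_private \<epsilon> {..<N} k M \<longrightarrow> 1 \<le> n \<longrightarrow>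
      err {..<N} M Q n \<le> ennreal \<alpha> \<longrightarrow> L * (\<epsilon> * \<alpha>) \<le> 1000000 * (\<epsilon> * \<alpha> * n))"
  proof (cases "16000 \<le> k")
    case True
    obtain S :: nat where S: "1 \<le> S" "46 * \<alpha> * sqrt S \<le> 1" "8 \<le> ln (N / S)" "8 \<le> k / (80 * S)"
      "L * (\<epsilon> * \<alpha>) \<le> 2000 * (sqrt S * ln (N / S))" "L * (\<epsilon> * \<alpha>) \<le> 2000 * (sqrt S * (k / (80 * S)))"
      using block_count_exists[where \<alpha> = \<alpha> and k = k and N = N] L * True by fastforce
    \<comment> \<open>The largest logarithm of a block size for which the blocks fit into the
      universe and the \<open>k\<close> queries still suffice for the union bound.\<close>
    define \<mu> where "\<mu> = min (ln (N / S)) (k / (80 * S))"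
    obtain B :: nat where B: "0 < B" "\<mu> / 2 \<le> ln B" "ln B \<le> \<mu>" "real B \<le> exp \<mu>"
      using floor_exp_bounds[of \<mu>] S(3,4) by (auto simp: \<mu>_def)
    have S0: "0 < real S" using S(1) by simp
    have ln4: "4 \<le> ln (real B)" using B(2) S(3,4) by (simp add: \<mu>_def)
    have "ln B \<le> k / (80 * S)" using B(3) by (simp add: \<mu>_def)
    then have k: "80 * real S * ln B \<le> k" using S0 by (simp add: field_simps)
    have "0 < real N" using * by auto
    then have "exp \<mu> \<le> N / S" using S0 by (subst ln_ge_iff[symmetric]) (auto simp: \<mu>_def)
    then have "real B \<le> N / S" using B(4) by simp
    then have "real (S * B) \<le> real N" using S0 by (simp add: field_simps)
    then have N: "S * B \<le> N" by (simp only: of_nat_le_iff)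
    have "L * (\<epsilon> * \<alpha>) \<le> 2000 * (sqrt S * \<mu>)" using S(5,6) by (simp add: \<mu>_def min_def)
    also have "\<dots> \<le> 4000 * (sqrt S * ln B)" using mult_left_mono[OF B(2), of "sqrt S"] by (simp add: mult.commute)
    finally have final: "L * (\<epsilon> * \<alpha>) \<le> 4000 * (sqrt S * ln B)" .
    have final_bound: "L * (\<epsilon> * \<alpha>) \<le> 1000000 * (\<epsilon> * \<alpha> * n)"
      if "sqrt S * ln B \<le> 92 * \<epsilon> * \<alpha> * n" for n :: nat
    proof -
      have "0 \<le> \<epsilon> * \<alpha> * n" using \<epsilon>\<alpha> by simp
      moreover have "sqrt S * ln B \<le> 92 * (\<epsilon> * \<alpha> * n)" using that by (simp add: mult.assoc)
      ultimately show ?thesis using final by linarith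
    qed
    from block_packing_bound[OF S(1) ln4 k N _ S(2), of \<epsilon>] * obtain Q where
      Q: "length Q = k" "bounded_workload {..<N} Q"
      "\<forall>M n. mechanism {..<N} k M \<longrightarrow> diff_private \<epsilon> {..<N} k M \<longrightarrow> 1 \<le> n \<longrightarrow>
        err {..<N} M Q n \<le> ennreal \<alpha> \<longrightarrow> sqrt S * ln B \<le> 92 * \<epsilon> * \<alpha> * n"
      by auto
    with final_bound show ?thesis by (intro exI[of _ Q]) simp
  next
    case False
    have "0 < \<alpha>\<^sup>2" "\<alpha>\<^sup>2 \<le> (1 / 1000)\<^sup>2"
      using * by (auto intro!: power_mono simp del: power_divide)
    then have "12 \<le> 2 / \<alpha>\<^sup>2" by (subst pos_le_divide_eq) (simp_all add: power_divide)
    then have N: "12 \<le> N" using * by linarith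
    obtain Q where Q: "length Q = k" "bounded_workload {..<N} Q"
      "\<forall>M n. mechanism {..<N} k M \<longrightarrow> diff_private \<epsilon> {..<N} k M \<longrightarrow> 1 \<le> n \<longrightarrow>
      err {..<N} M Q n \<le> ennreal \<alpha> \<longrightarrow> 1 \<le> 44 * \<epsilon> * \<alpha> * n"
      using constant_workload_bound[OF N, where k = k and \<alpha> = \<alpha> and \<epsilon> = \<epsilon>] * by auto
    have "L * (\<epsilon> * \<alpha>) \<le> 1000000 * (\<epsilon> * \<alpha> * n)" if "1 \<le> 44 * \<epsilon> * \<alpha> * n" for n :: nat
      using that False L(1) by simp
    with Q show ?thesis by blast
  qed
  then obtain Q where Q: "length Q = k" "bounded_workload {..<N} Q" and
    bound: "\<And>M n. mechanism {..<N} k M \<Longrightarrow> diff_private \<epsilon> {..<N} k M \<Longrightarrow> 1 \<le> n \<Longrightarrow>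
      err {..<N} M Q n \<le> ennreal \<alpha> \<Longrightarrow> L * (\<epsilon> * \<alpha>) \<le> 1000000 * (\<epsilon> * \<alpha> * n)" by blast
  have "ereal (1 / 1000000 * L) \<le> ereal_of_enat (private_sample_complexity \<epsilon> {..<N} Q \<alpha>)"
  proof (rule private_sample_complexity_ge)
    fix M n assume "mechanism {..<N} (length Q) M" "diff_private \<epsilon> {..<N} (length Q) M" "1 \<le> n"
      "err {..<N} M Q n \<le> ennreal \<alpha>"
    then have "L * (\<epsilon> * \<alpha>) \<le> 1000000 * (\<epsilon> * \<alpha> * n)" using bound Q(1) by simp
    then have "L * (\<epsilon> * \<alpha>) \<le> (1000000 * n) * (\<epsilon> * \<alpha>)" by (simp only: mult_ac)
    then show "1 / 1000000 * L \<le> real n" using \<epsilon>\<alpha> by (simp only: mult_le_cancel_right_pos)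
  qed
  then show "\<exists>(U::nat set) Q. finite U \<and> card U = N \<and> length Q = k \<and> bounded_workload U Q \<and>
        ereal_of_enat (private_sample_complexity \<epsilon> U Q \<alpha>) \<ge>
          ereal (1 / 1000000 * Min {real k / (\<epsilon> * \<alpha>),
                           sqrt (real k * ln (real N / real k)) / (\<epsilon> * \<alpha>),
                           ln (\<alpha>\<^sup>2 * real N) / (\<epsilon> * \<alpha>\<^sup>2)})"
    using Q by (intro exI[of _ "{..<N}"] exI[of _ Q]) (simp add: L_def)
qed

end
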